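(* Let $w\in S_n$, and let $(r,c)\in\operatorname{ess}(w)$ be such that for all $(r',c')\in D(w)$ with $(r',c')\neq(r,c)$, either $r'<r$ or $c'<c$. Let $w':=wt_{r,w^{-1}(c)}$. Then for any $S\subset[n]^2$ which contains $(r,c)$, we have $$\llbracket z^S\rrbracket\,\mathfrak{F}_w(z)=\llbracket z^{S\setminus\{(r,c)\}}\rrbracket\,\mathfrak{F}_{w'}(z).$$
   Context: $D(w)=\{(i,j)\in[n]^2:w(i)>j,\ w^{-1}(j)>i\}$ is the Rothe diagram, and $\operatorname{ess}(w)=\{(i,j)\in[n-1]^2: w(i)>j,\ w^{-1}(j)>i,\ w(i+1)\le j,\ w^{-1}(j+1)\le i\}$ is the essential set. $t_{i,j}$ is the transposition of $i$ and $j$, so $wt_{i,j}$ is $w$ with the values in positions $i$ and $j$ exchanged. $\llbracket m\rrbracket f$ is the coefficient of the monomial $m$ in $f$; $z^S=\prod_{(i,j)\in S}z_{i,j}$. Matrix Schubert variety: $r_{p\times q}(w)=\#\{(i,j): i\le p,\ j\le q,\ w(i)=j\}$, and $X_w\subset\mathbb{A}^{n^2}$ is the variety of $n\times n$ complex matrices whose northwest $p\times q$ submatrix has rank at most $r_{p\times q}(w)$ for all $p,q$. It is irreducible of codimension $\ell(w)$ (the Coxeter length). Fine Schubert polynomial: let $\overline{X}_w$ be the closure of $X_w$ in $(\mathbb{P}^1)^{n^2}\supset\mathbb{A}^{n^2}$ and $[H_{i,j}]\in H^2((\mathbb{P}^1)^{n^2})$ the class of the closure of $\{a_{i,j}=0\}$.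 $\mathfrak{F}_w(z)\in\mathbb{Z}[z_{i,j}:(i,j)\in[n]^2]$ is the unique polynomial, all of whose monomials are products of distinct variables, with $[\overline{X}_w]=\mathfrak{F}_w([H_{1,1}],\dots,[H_{n,n}])\cap[(\mathbb{P}^1)^{n^2}]$ (cap product). Equivalently it is homogeneous of degree $\ell(w)$, and for $|S|=\ell(w)$ the coefficient of $z^S$ is the degree of the coordinate projection $X_w\to\mathbb{A}^{[n]^2\setminus S}$ (zero if not dominant). *)

theory Defs
  imports
    Complex_Main
    "HOL-Library.FuncSet"
    "HOL-Library.Poly_Mapping"
    "HOL-Combinatorics.Permutations"
    "Jordan_Normal_Form.DL_Rank"
begin

section \<open>Permutations and their diagrams\<close>

text \<open>An element of $S_n$ is a function \<open>w :: nat \<Rightarrow> nat\<close> with \<open>w permutes {1..n}\<close>.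
  All indices are 1-based.\<close>

definition grid :: "nat \<Rightarrow> (nat \<times> nat) set" where
  "grid n = {1..n} \<times> {1..n}"

definition rothe :: "nat \<Rightarrow> (nat \<Rightarrow> nat) \<Rightarrow> (nat \<times> nat) set" where
  "rothe n w = {(i, j) \<in> grid n. w i > j \<and> Hilbert_Choice.inv w j > i}"

definition ess :: "nat \<Rightarrow> (nat \<Rightarrow> nat) \<Rightarrow> (nat \<times> nat) set" where
  "ess n w = {(i, j) \<in> grid (n - 1).
     w i > j \<and> Hilbert_Choice.inv w j > i \<and> w (i + 1) \<le> j \<and> Hilbert_Choice.inv w (j + 1) \<le> i}"

definition coxeter_length :: "nat \<Rightarrow> (nat \<Rightarrow> nat) \<Rightarrow> nat" where
  "coxeter_length n w = (LEAST k. \<exists>is. length is = k \<and> set is \<subseteq> {1..<n} \<and>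
     w = foldr (\<circ>) (map (\<lambda>i. Transposition.transpose i (i + 1)) is) id)"


section \<open>Affine spaces and polynomials\<close>

text \<open>\<open>aff T\<close> is the complex affine space with coordinates indexed by \<open>T\<close>; its points are
  extensional functions, so that the coordinate projection from \<open>aff T'\<close> onto \<open>aff T\<close>, for
  \<open>T \<subseteq> T'\<close>, is \<open>\<lambda>a. restrict a T\<close>.\<close>

type_synonym point = "nat \<times> nat \<Rightarrow> complex"

definition aff :: "(nat \<times> nat) set \<Rightarrow> point set" where
  "aff T = T \<rightarrow>\<^sub>E UNIV"

text \<open>A polynomial in the variables $z_{i,j}$ is a finitely supported function from monomials to
  coefficients, and a monomial is a finitely supported function from variables to exponents.\<close>

type_synonym 'a mpol = "((nat \<times> nat) \<Rightarrow>\<^sub>0 nat) \<Rightarrow>\<^sub>0 'a"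

definition pvars :: "complex mpol \<Rightarrow> (nat \<times> nat) set" where
  "pvars p = (\<Union>m \<in> Poly_Mapping.keys p. Poly_Mapping.keys m)"

definition peval :: "complex mpol \<Rightarrow> point \<Rightarrow> complex" where
  "peval p a = (\<Sum>m \<in> Poly_Mapping.keys p. Poly_Mapping.lookup p m *
     (\<Prod>v \<in> Poly_Mapping.keys m. a v ^ Poly_Mapping.lookup m v))"

definition zariski_closed :: "(nat \<times> nat) set \<Rightarrow> point set \<Rightarrow> bool" where
  "zariski_closed T C \<longleftrightarrow>
     (\<exists>I. (\<forall>p \<in> I. pvars p \<subseteq> T) \<and> C = {a \<in> aff T. \<forall>p \<in> I. peval p a = 0})"


section \<open>Matrix Schubert varieties\<close>

definition nw_rank :: "(nat \<Rightarrow> nat) \<Rightarrow> nat \<Rightarrow> nat \<Rightarrow> nat" where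
  "nw_rank w p q = card {(i, j). i \<in> {1..p} \<and> j \<in> {1..q} \<and> w i = j}"

text \<open>Matrices of type \<open>complex mat\<close> are indexed from 0, hence the shift.\<close>

definition nw_submatrix :: "point \<Rightarrow> nat \<Rightarrow> nat \<Rightarrow> complex mat" where
  "nw_submatrix a p q = mat p q (\<lambda>(i, j). a (i + 1, j + 1))"

definition matrix_schubert :: "nat \<Rightarrow> (nat \<Rightarrow> nat) \<Rightarrow> point set" where
  "matrix_schubert n w = {a \<in> aff (grid n).
     \<forall>p \<in> {1..n}. \<forall>q \<in> {1..n}. vec_space.rank p (nw_submatrix a p q) \<le> nw_rank w p q}"


section \<open>Degree of a coordinate projection\<close>

definition proj_dominant :: "point set \<Rightarrow> (nat \<times> nat) set \<Rightarrow> bool" where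
  "proj_dominant X T \<longleftrightarrow>
     (\<forall>C. zariski_closed T C \<and> (\<lambda>a. restrict a T) ` X \<subseteq> C \<longrightarrow> C = aff T)"

text \<open>Over the complex numbers, the degree of a dominant map between irreducible varieties of the
  same dimension is the number of points in a general fibre, i.e. in the fibre over any point of
  some nonempty Zariski open subset of the target. This number is unique because \<open>aff T\<close> is
  irreducible for finite \<open>T\<close>.\<close>

definition proj_degree :: "point set \<Rightarrow> (nat \<times> nat) set \<Rightarrow> nat" where
  "proj_degree X T = (if proj_dominant X T
     then (THE d. \<exists>C. zariski_closed T C \<and> C \<noteq> aff T \<and>
             (\<forall>b \<in> aff T - C. finite {a \<in> X. restrict a T = b} \<and>
                               card {a \<in> X. restrict a T = b} = d))
     else 0)"


section \<open>Fine Schubert polynomials\<close>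

text \<open>The monomial $z^S$, for finite \<open>S\<close>.\<close>

definition zmon :: "(nat \<times> nat) set \<Rightarrow> (nat \<times> nat) \<Rightarrow>\<^sub>0 nat" where
  "zmon S = (\<Sum>v \<in> S. Poly_Mapping.single v 1)"

text \<open>The fine Schubert polynomial represents the class of the closure of the matrix Schubert
  variety in $(\mathbb{P}^1)^{n^2}$ in the basis of squarefree monomials in the hyperplane classes
  $[H_{i,j}]$. It is homogeneous of degree the Coxeter length, the codimension of the variety,
  and the coefficient of $z^S$ is the intersection number of that class with the product of the
  $[H_{i,j}]$ for \<open>(i, j) \<notin> S\<close>, which is the degree of the projection forgetting the
  coordinates in \<open>S\<close>. That description is the definition used here.\<close>

definition fine_schubert :: "nat \<Rightarrow> (nat \<Rightarrow> nat) \<Rightarrow> int mpol" where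
  "fine_schubert n w = (\<Sum>S \<in> {S. S \<subseteq> grid n \<and> card S = coxeter_length n w}.
     Poly_Mapping.single (zmon S) (int (proj_degree (matrix_schubert n w) (grid n - S))))"

end

theory Submission
  imports Defs "HOL-Library.Function_Algebras"
begin

text \<open>Let \<open>v\<close> be the permutation \<open>w'\<close> of the statement, \<open>e = (r, c)\<close>, and \<open>k\<close> the number of dots of \<open>w\<close>
  northwest of \<open>e\<close>. No box of the diagram of \<open>v\<close> lies weakly southeast of \<open>e\<close>, so $X_v$ is a cylinder in
  the direction \<open>e\<close>, and $X_w$ is cut out of $X_v$ by the single condition that the northwest submatrix
  with corner \<open>e\<close> has rank at most \<open>k\<close>. Where the submatrix strictly northwest of \<open>e\<close> has rank \<open>k\<close>,
  this condition determines the entry at \<open>e\<close>, so there $X_w$ is a graph over the base of $X_v$ and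
  the fibres of the two projections correspond.

  The remaining matrices of $X_v$ are harmless because their dimension is too small. They are
  stratified by the pivot positions of their rows under elimination. A stratum with pivots \<open>f\<close> is
  the image of a polynomial map whose parameters are indexed by the complement of the diagram
  of \<open>f\<close>, and this diagram is larger than that of \<open>v\<close> whenever \<open>f \<noteq> v\<close> has no more dots than
  \<open>v\<close> in any northwest rectangle. Counting monomials shows that the image is not dense.\<close>

section \<open>Ranks of northwest submatrices\<close>

text \<open>The degree is a \<open>THE\<close> over generic fibres, so it is compared rather than
  computed: changing the coordinate \<open>e\<close> maps fibres of one projection bijectively onto
  fibres of the other, and the whole predicate in \<open>d\<close> is transported along this
  bijection. The word "generic" has to be flexible for that, whence exceptional sets that are merely
  killed by one nonzero polynomial function; they survive unions, slices and cylinders.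

  The obstacle is the locus of small corner rank, where the entry at \<open>(r, c)\<close> need not
  be determined. Because $X_v$ contains singular matrices, its strata are labelled by partial
  permutations, and codimensions must be compared in a Bruhat order on these. The comparison is
  sharp: forgetting \<open>coxeter_length n v\<close> coordinates leaves exactly as many as the
  stratum of \<open>v\<close> has parameters, and every other stratum has at least one fewer. This
  is why the length, defined by words, has to be identified with the number of boxes.\<close>

global_interpretation fs: vector_space "\<lambda>c (g :: 'a \<Rightarrow> complex) x. c * g x"
  by unfold_locales (auto simp: fun_eq_iff algebra_simps)

text \<open>A maximal independent subset of \<open>S\<close> remains maximal in
  \<open>insert v S\<close> after adjoining \<open>v\<close>, unless \<open>v\<close> is already
  spanned. For columns, this makes the rank grow by 0 or 1 at each step.\<close>

lemma (in vectorspace) dim_span_insert: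
  assumes S: "S \<subseteq> carrier V" "finite S" and v: "v \<in> carrier V"
  shows "vectorspace.dim K (span_vs (insert v S))
       = vectorspace.dim K (span_vs S) + (if v \<in> span S then 0 else 1)"
proof (cases "v \<in> span S")
  case True
  have "span (insert v S) = span S"
    using already_in_span[OF S(1) True] by simp
  then show ?thesis using True by simp
next
  case False
  obtain U where U: "finite U" "maximal U (\<lambda>T. T \<subseteq> S \<and> lin_indpt T)"
  proof -
    have "lin_indpt {}" by (rule finite_lin_indpt2) auto
    then have "\<exists>U. finite U \<and> maximal U (\<lambda>T. T \<subseteq> S \<and> lin_indpt T) \<and> {} \<subseteq> U"
      by (intro maximal_exists_superset[OF S(2)]) auto
    then show ?thesis using that by blast
  qed
  have US: "U \<subseteq> S" "lin_indpt U" using U(2) unfolding maximal_def by auto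
  have vU: "v \<notin> span U" using False US(1) span_is_monotone by blast
  then have "v \<notin> U" using US(1) S(1) span_mem by blast
  have ind: "lin_indpt (insert v U)"
    using lin_dep_iff_in_span[OF _ US(2) v \<open>v \<notin> U\<close>] US(1) S(1) vU by auto
  have vS: "v \<notin> S" using False S span_mem by blast
  have "maximal (insert v U) (\<lambda>T. T \<subseteq> insert v S \<and> lin_indpt T)"
    unfolding maximal_def
  proof (intro conjI allI impI)
    show "insert v U \<subseteq> insert v S" using US by auto
    show "lin_indpt (insert v U)" by (rule ind)
    fix T assume T: "insert v U \<subseteq> T \<and> T \<subseteq> insert v S \<and> lin_indpt T"
    then have "lin_indpt (T - {v})" using subset_li_is_li by (meson Diff_subset)
    moreover have "T - {v} \<subseteq> S" "U \<subseteq> T - {v}" using T \<open>v \<notin> U\<close> by auto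
    ultimately have "T - {v} = U" using U(2) unfolding maximal_def by (metis (no_types, lifting))
    then show "T = insert v U" using T by auto
  qed
  then have "vectorspace.dim K (span_vs (insert v S)) = card (insert v U)"
    using dim_span[of "insert v S"] S v by auto
  moreover have "vectorspace.dim K (span_vs S) = card U"
    using dim_span[of S] S U by auto
  ultimately show ?thesis using False \<open>v \<notin> U\<close> U(1) by simp
qed

definition rk :: "point \<Rightarrow> nat \<Rightarrow> nat \<Rightarrow> nat" where
  "rk a p q = vec_space.rank p (nw_submatrix a p q)"

text \<open>Only earlier columns may occur, so the columns violating this are the pivot columns; for
  \<open>q = 1\<close> the sum is empty and dependence means a zero column.\<close>

definition col_dep :: "point \<Rightarrow> nat \<Rightarrow> nat \<Rightarrow> bool" where
  "col_dep a p q \<longleftrightarrow> (\<exists>y. \<forall>i\<in>{1..p}. a (i, q) = (\<Sum>j\<in>{1..<q}. y j * a (i, j)))"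

definition row_dep :: "point \<Rightarrow> nat \<Rightarrow> nat \<Rightarrow> bool" where
  "row_dep a p q \<longleftrightarrow> (\<exists>y. \<forall>j\<in>{1..q}. a (p, j) = (\<Sum>i\<in>{1..<p}. y i * a (i, j)))"

text \<open>Passes from the dimension of a column space to linear relations between entries of
  \<open>a\<close>, the form that inductions on the size of the submatrix use.\<close>

lemma rk_Suc_col: "rk a p (Suc q) = rk a p q + (if col_dep a p (Suc q) then 0 else 1)"
proof -
  interpret vec_space "TYPE(complex)" p .
  let ?A = "nw_submatrix a p q" and ?v = "vec p (\<lambda>i. a (Suc i, Suc q))"
  have cA: "?A \<in> carrier_mat p q" by (simp add: nw_submatrix_def)
  have sub: "set (cols ?A) \<subseteq> carrier_vec p" using cA cols_dim[of ?A] by (simp add: nw_submatrix_def)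
  have "set (cols (nw_submatrix a p (Suc q))) = insert ?v (set (cols ?A))"
  proof -
    have "set (cols (nw_submatrix a p (Suc q))) = (\<lambda>j. vec p (\<lambda>i. a (Suc i, Suc j))) ` {..<Suc q}"
      and "set (cols ?A) = (\<lambda>j. vec p (\<lambda>i. a (Suc i, Suc j))) ` {..<q}"
      unfolding cols_def nw_submatrix_def
      by (auto simp: atLeast0LessThan intro!: image_cong eq_vecI simp del: upt_Suc)
    then show ?thesis by (simp add: lessThan_Suc)
  qed
  then have "rk a p (Suc q) = rk a p q + (if ?v \<in> span (set (cols ?A)) then 0 else 1)"
    unfolding rk_def rank_def using dim_span_insert[of "set (cols ?A)" ?v] sub by simp
  moreover have "?v \<in> span (set (cols ?A)) \<longleftrightarrow> col_dep a p (Suc q)"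
  proof -
    have "?v \<in> span (set (cols ?A)) \<longleftrightarrow> (\<exists>x\<in>carrier_vec q. ?A *\<^sub>v x = ?v)"
      using col_space_eq[OF cA] cA by (auto simp: col_space_def)
    also have "\<dots> \<longleftrightarrow> (\<exists>y. \<forall>i\<in>{1..p}. a (i, Suc q) = (\<Sum>j\<in>{1..<Suc q}. y j * a (i, j)))"
    proof
      assume "\<exists>x\<in>carrier_vec q. ?A *\<^sub>v x = ?v"
      then obtain x where x: "x \<in> carrier_vec q" "?A *\<^sub>v x = ?v" by auto
      show "\<exists>y. \<forall>i\<in>{1..p}. a (i, Suc q) = (\<Sum>j\<in>{1..<Suc q}. y j * a (i, j))"
      proof (intro exI ballI)
        fix i assume i: "i \<in> {1..p}"
        then obtain i' where i': "i = Suc i'" "i' < p" by (cases i) auto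
        have "a (i, Suc q) = (?A *\<^sub>v x) $ (i - 1)" using x i' by simp
        also have "\<dots> = (\<Sum>j<q. a (i, Suc j) * x $ j)" using i' x(1)
          by (simp add: nw_submatrix_def scalar_prod_def atLeast0LessThan)
        also have "\<dots> = (\<Sum>j\<in>{1..<Suc q}. x $ (j - 1) * a (i, j))"
          by (rule sum.reindex_bij_witness[of _ "\<lambda>j. j - 1" Suc]) (auto simp: mult.commute)
        finally show "a (i, Suc q) = (\<Sum>j\<in>{1..<Suc q}. x $ (j - 1) * a (i, j))" .
      qed
    next
      assume "\<exists>y. \<forall>i\<in>{1..p}. a (i, Suc q) = (\<Sum>j\<in>{1..<Suc q}. y j * a (i, j))"
      then obtain y where y: "\<forall>i\<in>{1..p}. a (i, Suc q) = (\<Sum>j\<in>{1..<Suc q}. y j * a (i, j))" by auto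
      show "\<exists>x\<in>carrier_vec q. ?A *\<^sub>v x = ?v"
      proof (intro bexI eq_vecI)
        show "vec q (\<lambda>j. y (Suc j)) \<in> carrier_vec q" by simp
        fix i assume "i < dim_vec ?v"
        then have i: "i < p" by simp
        have "(?A *\<^sub>v vec q (\<lambda>j. y (Suc j))) $ i = (\<Sum>j<q. a (Suc i, Suc j) * y (Suc j))"
          using i by (simp add: nw_submatrix_def scalar_prod_def atLeast0LessThan)
        also have "\<dots> = (\<Sum>j\<in>{1..<Suc q}. y j * a (Suc i, j))"
          by (rule sum.reindex_bij_witness[of _ "\<lambda>j. j - 1" Suc]) (auto simp: mult.commute)
        also have "\<dots> = ?v $ i" using y i by auto
        finally show "(?A *\<^sub>v vec q (\<lambda>j. y (Suc j))) $ i = ?v $ i" .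
      qed (simp add: nw_submatrix_def)
    qed
    finally show ?thesis by (simp add: col_dep_def)
  qed
  ultimately show ?thesis by simp
qed

lemma card_filter_Suc:
  "card {j \<in> {1..Suc q}. P j} = card {j \<in> {1..q}. P j} + (if P (Suc q) then 1 else 0)"
proof -
  have "{j \<in> {1..Suc q}. P j} = (if P (Suc q) then insert (Suc q) {j \<in> {1..q}. P j} else {j \<in> {1..q}. P j})"
    by (auto simp: le_Suc_eq)
  then show ?thesis by auto
qed

lemma rk_eq_card_cols: "rk a p q = card {j \<in> {1..q}. \<not> col_dep a p j}"
proof (induction q)
  case 0
  interpret vec_space "TYPE(complex)" p .
  have "rk a p 0 = 0" unfolding rk_def
    using rank_le_nc[of "nw_submatrix a p 0" 0] by (simp add: nw_submatrix_def)
  then show ?case by simp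
next
  case (Suc q)
  then show ?case using rk_Suc_col[of a p q] card_filter_Suc[of q "\<lambda>j. \<not> col_dep a p j"] by auto
qed

text \<open>A factorization through a \<open>k\<close>-dimensional space. Unlike
  \<open>col_dep\<close> it is symmetric in rows and columns, which is how column rank turns into
  row rank.\<close>

definition factors :: "point \<Rightarrow> nat \<Rightarrow> nat \<Rightarrow> nat \<Rightarrow> bool" where
  "factors a p q k \<longleftrightarrow>
     (\<exists>u v. \<forall>i\<in>{1..p}. \<forall>j\<in>{1..q}. a (i, j) = (\<Sum>l<k. u i l * v l j))"

text \<open>A dependent column is expressed in the old inner coordinates; an independent one
  receives a new inner index of its own, namely \<open>rk a p q\<close>.\<close>

lemma factors_rk: "factors a p q (rk a p q)"
proof (induction q)
  case 0
  then show ?case by (simp add: factors_def)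
next
  case (Suc q)
  then obtain u v where uv: "\<forall>i\<in>{1..p}. \<forall>j\<in>{1..q}. a (i, j) = (\<Sum>l<rk a p q. u i l * v l j)"
    unfolding factors_def by auto
  show ?case
  proof (cases "col_dep a p (Suc q)")
    case True
    then obtain y where y: "\<forall>i\<in>{1..p}. a (i, Suc q) = (\<Sum>j\<in>{1..<Suc q}. y j * a (i, j))"
      unfolding col_dep_def by auto
    let ?v = "\<lambda>l j. if j = Suc q then (\<Sum>j\<in>{1..q}. y j * v l j) else v l j"
    have "a (i, Suc q) = (\<Sum>l<rk a p q. u i l * (\<Sum>j\<in>{1..q}. y j * v l j))" if "i \<in> {1..p}" for i
    proof -
      have "a (i, Suc q) = (\<Sum>j\<in>{1..q}. y j * (\<Sum>l<rk a p q. u i l * v l j))"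
        using y uv that by (auto simp: atLeastLessThanSuc_atLeastAtMost intro!: sum.cong)
      also have "\<dots> = (\<Sum>l<rk a p q. \<Sum>j\<in>{1..q}. y j * (u i l * v l j))"
        by (subst sum.swap) (simp add: sum_distrib_left)
      finally show ?thesis by (simp add: sum_distrib_left algebra_simps)
    qed
    then have "\<forall>i\<in>{1..p}. \<forall>j\<in>{1..Suc q}. a (i, j) = (\<Sum>l<rk a p q. u i l * ?v l j)"
      using uv by (auto simp: le_Suc_eq)
    moreover have "rk a p (Suc q) = rk a p q" using True rk_Suc_col by simp
    ultimately show ?thesis unfolding factors_def by (intro exI[of _ u] exI[of _ ?v]) simp
  next
    case False
    let ?k = "rk a p q"
    let ?u = "\<lambda>i l. if l = ?k then a (i, Suc q) else u i l"
    let ?v = "\<lambda>l j. if j = Suc q then (if l = ?k then 1 else 0) else if l = ?k then 0 else v l j"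
    have "a (i, j) = (\<Sum>l<Suc ?k. ?u i l * ?v l j)" if "i \<in> {1..p}" "j \<in> {1..Suc q}" for i j
    proof (cases "j = Suc q")
      case True
      have "(\<Sum>l<?k. ?u i l * ?v l j) = 0" using True by (intro sum.neutral) auto
      then show ?thesis using True by simp
    next
      case False
      have "(\<Sum>l<?k. ?u i l * ?v l j) = (\<Sum>l<?k. u i l * v l j)" using False by (intro sum.cong) auto
      then show ?thesis using False uv that by auto
    qed
    moreover have "rk a p (Suc q) = Suc ?k" using False rk_Suc_col by simp
    ultimately show ?thesis unfolding factors_def
      by (intro exI[of _ ?u] exI[of _ ?v]) (simp del: sum.lessThan_Suc)
  qed
qed

lemma sum_fun_apply: "(\<Sum>i\<in>I. f i) x = (\<Sum>i\<in>I. (f i x :: complex))"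
  by (induction I rule: infinite_finite_induct) auto

lemma fs_span_imageE:
  fixes C :: "'i \<Rightarrow> 'a \<Rightarrow> complex"
  assumes "g \<in> fs.span (C ` J)" and J: "finite J"
  obtains y where "\<And>x. g x = (\<Sum>j\<in>J. y j * C j x)"
proof -
  have "\<exists>y. \<forall>x. g x = (\<Sum>j\<in>J. y j * C j x)" using assms(1)
  proof (induction rule: fs.span_induct_alt)
    case base
    show ?case by (intro exI[of _ "\<lambda>_. 0"]) simp
  next
    case (step c b g)
    obtain j0 where j0: "j0 \<in> J" "b = C j0" using step(1) by auto
    obtain y where y: "\<forall>x. g x = (\<Sum>j\<in>J. y j * C j x)" using step(2) by auto
    have "c * b x + g x = (\<Sum>j\<in>J. (y j + (if j = j0 then c else 0)) * C j x)" for x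
    proof -
      have "(\<Sum>j\<in>J. (if j = j0 then c else 0) * C j x) = c * C j0 x"
        using J j0 by (simp add: if_distrib[of "\<lambda>z. z * _"] cong: if_cong)
      then show ?thesis using y j0 by (simp add: distrib_right sum.distrib)
    qed
    then show ?case by (intro exI[of _ "\<lambda>j. y j + (if j = j0 then c else 0)"]) simp
  qed
  then show ?thesis using that by blast
qed

text \<open>The pivot columns are independent and lie in the span of the \<open>k\<close> columns of
  the left factor, so the exchange bound applies. Columns are set to 0 outside the rows
  \<open>{1..p}\<close>, so that equality of functions is equality in these rows.\<close>

lemma rk_le_if_factors:
  assumes "factors a p q k"
  shows "rk a p q \<le> k"
proof -
  obtain u v where uv: "\<forall>i\<in>{1..p}. \<forall>j\<in>{1..q}. a (i, j) = (\<Sum>l<k. u i l * v l j)"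
    using assms unfolding factors_def by auto
  define C where "C j = (\<lambda>i. if i \<in> {1..p} then a (i, j) else 0)" for j
  define U where "U l = (\<lambda>i. if i \<in> {1..p} then u i l else 0)" for l
  have dep: "col_dep a p j" if sp: "C j \<in> fs.span (C ` {1..<j})" for j
  proof -
    obtain y where y: "\<And>x. C j x = (\<Sum>j'\<in>{1..<j}. y j' * C j' x)"
      using fs_span_imageE[OF sp] by auto
    have "\<forall>i\<in>{1..p}. a (i, j) = (\<Sum>j'\<in>{1..<j}. y j' * a (i, j'))"
    proof
      fix i assume "i \<in> {1..p}"
      then show "a (i, j) = (\<Sum>j'\<in>{1..<j}. y j' * a (i, j'))" using y[of i] by (simp add: C_def)
    qed
    then show ?thesis unfolding col_dep_def by blast
  qed
  have "\<exists>s. fs.independent s \<and> finite s \<and> s \<subseteq> C ` {1..q'} \<and> card s = rk a p q'" for q'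
  proof (induction q')
    case 0
    show ?case by (intro exI[of _ "{}"]) (auto simp: rk_eq_card_cols fs.independent_empty)
  next
    case (Suc q')
    then obtain s where s: "fs.independent s" "finite s" "s \<subseteq> C ` {1..q'}" "card s = rk a p q'" by auto
    show ?case
    proof (cases "col_dep a p (Suc q')")
      case True
      then show ?thesis using s rk_Suc_col[of a p q'] by (intro exI[of _ s]) auto
    next
      case False
      then have "C (Suc q') \<notin> fs.span (C ` {1..<Suc q'})" using dep by blast
      then have ns: "C (Suc q') \<notin> fs.span s" using fs.span_mono[OF s(3)]
        by (auto simp: atLeastLessThanSuc_atLeastAtMost)
      then have "C (Suc q') \<notin> s" using fs.span_base by blast
      then have "card (insert (C (Suc q')) s) = rk a p (Suc q')"
        using s False rk_Suc_col[of a p q'] by simp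
      moreover have "fs.independent (insert (C (Suc q')) s)"
        using s(1) ns fs.independent_insertI by blast
      moreover have "insert (C (Suc q')) s \<subseteq> C ` {1..Suc q'}" using s(3) by auto
      ultimately show ?thesis using s(2) by blast
    qed
  qed
  then obtain s where s: "fs.independent s" "finite s" "s \<subseteq> C ` {1..q}" "card s = rk a p q" by blast
  have "C j \<in> fs.span (U ` {..<k})" if "j \<in> {1..q}" for j
  proof -
    have "C j = (\<Sum>l<k. (\<lambda>x. v l j * U l x))"
      using uv that by (auto simp: C_def U_def fun_eq_iff sum_fun_apply mult.commute intro!: sum.cong)
    also have "\<dots> \<in> fs.span (U ` {..<k})"
      by (intro fs.span_sum fs.span_scale fs.span_base) auto
    finally show ?thesis .
  qed
  then have "s \<subseteq> fs.span (U ` {..<k})" using s(3) by auto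
  then have "card s \<le> card (U ` {..<k})" using fs.independent_span_bound[of "U ` {..<k}" s] s by auto
  also have "\<dots> \<le> k" using card_image_le[of "{..<k}" U] by simp
  finally show ?thesis using s by simp
qed

lemma rk_swap: "rk (\<lambda>(i, j). a (j, i)) q p = rk a p q"
proof -
  have swap: "factors (\<lambda>(i, j). b (j, i)) q p k \<longleftrightarrow> factors b p q k" for b p q k
  proof
    assume "factors b p q k"
    then obtain u v where "\<forall>i\<in>{1..p}. \<forall>j\<in>{1..q}. b (i, j) = (\<Sum>l<k. u i l * v l j)"
      unfolding factors_def by auto
    then show "factors (\<lambda>(i, j). b (j, i)) q p k" unfolding factors_def
      by (intro exI[of _ "\<lambda>j l. v l j"] exI[of _ "\<lambda>l i. u i l"]) (auto simp: mult.commute)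
  next
    assume "factors (\<lambda>(i, j). b (j, i)) q p k"
    then obtain u v where "\<forall>i\<in>{1..q}. \<forall>j\<in>{1..p}. b (j, i) = (\<Sum>l<k. u i l * v l j)"
      unfolding factors_def by auto
    then show "factors b p q k" unfolding factors_def
      by (intro exI[of _ "\<lambda>j l. v l j"] exI[of _ "\<lambda>l i. u i l"]) (auto simp: mult.commute)
  qed
  show ?thesis
  proof (rule antisym)
    show "rk (\<lambda>(i, j). a (j, i)) q p \<le> rk a p q"
      by (rule rk_le_if_factors) (simp only: swap factors_rk)
    show "rk a p q \<le> rk (\<lambda>(i, j). a (j, i)) q p"
      using factors_rk[of "\<lambda>(i, j). a (j, i)" q p] by (intro rk_le_if_factors) (simp only: swap)
  qed
qed

lemma rk_eq_card_rows: "rk a p q = card {i \<in> {1..p}. \<not> row_dep a i q}"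
proof -
  have "row_dep a i q \<longleftrightarrow> col_dep (\<lambda>(i, j). a (j, i)) q i" for i
    unfolding row_dep_def col_dep_def by simp
  then show ?thesis using rk_eq_card_cols[of "\<lambda>(i, j). a (j, i)" q p] by (simp add: rk_swap)
qed

lemma rk_Suc_row: "rk a (Suc p) q = rk a p q + (if row_dep a (Suc p) q then 0 else 1)"
  using rk_eq_card_rows card_filter_Suc[of p "\<lambda>i. \<not> row_dep a i q"] by auto

lemma rk_0_row [simp]: "rk a 0 q = 0" and rk_0_col [simp]: "rk a p 0 = 0"
  using rk_eq_card_rows[of a 0 q] rk_eq_card_cols[of a p 0] by auto

lemma rk_cong:
  assumes "\<And>i j. i \<in> {1..p} \<Longrightarrow> j \<in> {1..q} \<Longrightarrow> a (i, j) = b (i, j)"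
  shows "rk a p q = rk b p q"
proof -
  have "nw_submatrix a p q = nw_submatrix b p q" unfolding nw_submatrix_def
    using assms by (intro cong_mat) auto
  then show ?thesis by (simp add: rk_def)
qed

lemma row_dep_mono: "row_dep a p q \<Longrightarrow> q' \<le> q \<Longrightarrow> row_dep a p q'"
  unfolding row_dep_def by (meson atLeastAtMost_iff le_trans)

section \<open>Polynomial functions and non-dense sets\<close>

definition pmon :: "(nat \<times> nat) set \<Rightarrow> (nat \<times> nat \<Rightarrow> nat) \<Rightarrow> point \<Rightarrow> complex" where
  "pmon T k a = (\<Prod>v\<in>T. a v ^ k v)"

text \<open>The exponent of each variable is bounded separately, so that there are exactly
  \<open>(M + 1) ^ card T\<close> exponent vectors for finite \<open>T\<close>.\<close>

definition polyfun_le :: "(nat \<times> nat) set \<Rightarrow> nat \<Rightarrow> (point \<Rightarrow> complex) set" where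
  "polyfun_le T M = fs.span (pmon T ` (T \<rightarrow>\<^sub>E {..M}))"

definition polyfun :: "(nat \<times> nat) set \<Rightarrow> (point \<Rightarrow> complex) set" where
  "polyfun T = (\<Union>M. polyfun_le T M)"

lemma pmon_restrict [simp]: "pmon T (restrict k T) = pmon T k"
  by (auto simp: pmon_def fun_eq_iff)

lemma pmon_in_polyfun_le: "(\<And>v. v \<in> T \<Longrightarrow> k v \<le> M) \<Longrightarrow> pmon T k \<in> polyfun_le T M"
  unfolding polyfun_le_def
  by (rule fs.span_base, rule image_eqI[of _ _ "restrict k T"]) auto

lemma polyfun_le_mono: "M \<le> N \<Longrightarrow> polyfun_le T M \<subseteq> polyfun_le T N"
  unfolding polyfun_le_def by (rule fs.span_mono, rule image_mono, rule PiE_mono) auto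

lemma polyfun_le_add: "f \<in> polyfun_le T M \<Longrightarrow> g \<in> polyfun_le T M \<Longrightarrow> (\<lambda>a. f a + g a) \<in> polyfun_le T M"
  using fs.span_add[of f _ g] by (simp add: polyfun_le_def plus_fun_def)

lemma polyfun_le_scale: "f \<in> polyfun_le T M \<Longrightarrow> (\<lambda>a. c * f a) \<in> polyfun_le T M"
  unfolding polyfun_le_def by (rule fs.span_scale)

lemma polyfun_le_0: "(\<lambda>a. 0) \<in> polyfun_le T M"
  using fs.span_zero by (simp add: polyfun_le_def zero_fun_def)

lemma polyfun_le_mult:
  assumes "f \<in> polyfun_le T M" "g \<in> polyfun_le T N"
  shows "(\<lambda>a. f a * g a) \<in> polyfun_le T (M + N)"
  using assms(1) unfolding polyfun_le_def[of T M]
proof (induction rule: fs.span_induct_alt)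
  case base
  show ?case by (simp add: polyfun_le_0)
next
  case (step c m f)
  then obtain k where k: "k \<in> T \<rightarrow>\<^sub>E {..M}" "m = pmon T k" by auto
  have "(\<lambda>a. m a * g a) \<in> polyfun_le T (M + N)"
    using assms(2) unfolding polyfun_le_def[of T N]
  proof (induction rule: fs.span_induct_alt)
    case base
    show ?case by (simp add: polyfun_le_0)
  next
    case (step d m' g)
    then obtain l where l: "l \<in> T \<rightarrow>\<^sub>E {..N}" "m' = pmon T l" by auto
    have "(\<lambda>a. m a * m' a) = pmon T (\<lambda>v. k v + l v)"
      using k l by (auto simp: pmon_def fun_eq_iff power_add prod.distrib)
    moreover have "pmon T (\<lambda>v. k v + l v) \<in> polyfun_le T (M + N)"
      using k l by (intro pmon_in_polyfun_le add_mono) (auto simp: PiE_iff)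
    ultimately have "(\<lambda>a. d * (m a * m' a) + m a * g a) \<in> polyfun_le T (M + N)"
      using step(2) by (intro polyfun_le_add polyfun_le_scale) auto
    then show ?case by (simp add: algebra_simps)
  qed
  then have "(\<lambda>a. c * (m a * g a) + f a * g a) \<in> polyfun_le T (M + N)"
    using step(2) by (intro polyfun_le_add polyfun_le_scale) auto
  then show ?case by (simp add: algebra_simps)
qed

lemma polyfun_le_const: "(\<lambda>a. c) \<in> polyfun_le T M"
  using polyfun_le_scale[OF pmon_in_polyfun_le[of T "\<lambda>_. 0" M], of c] by (simp add: pmon_def)

lemma polyfun_le_var:
  assumes "finite T" "v \<in> T"
  shows "(\<lambda>a. a v) \<in> polyfun_le T 1"
proof -
  have "pmon T (\<lambda>u. if u = v then 1 else 0) = (\<lambda>a. a v)"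
  proof
    fix a
    have "pmon T (\<lambda>u. if u = v then 1 else 0) a = (\<Prod>u\<in>T. if u = v then a v else 1)"
      unfolding pmon_def by (intro prod.cong) auto
    then show "pmon T (\<lambda>u. if u = v then 1 else 0) a = a v" using assms by simp
  qed
  then show ?thesis using pmon_in_polyfun_le[of T "\<lambda>u. if u = v then 1 else 0" 1] by simp
qed

lemma polyfun_le_power:
  assumes "f \<in> polyfun_le T M"
  shows "(\<lambda>a. f a ^ e) \<in> polyfun_le T (M * e)"
proof (induction e)
  case 0
  show ?case by (simp add: polyfun_le_const)
next
  case (Suc e)
  then show ?case using polyfun_le_mult[OF assms Suc] by simp
qed

text \<open>For fixed \<open>M\<close> and \<open>I\<close> the bound is linear in \<open>N\<close>;
  the monomial count relies on this growth rate.\<close>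

lemma polyfun_le_pmon:
  assumes "finite I" "\<And>v. v \<in> I \<Longrightarrow> f v \<in> polyfun_le T M" "\<And>v. v \<in> I \<Longrightarrow> k v \<le> N"
  shows "(\<lambda>a. pmon I k (\<lambda>v. f v a)) \<in> polyfun_le T (M * N * card I)"
  using assms
proof (induction I)
  case empty
  show ?case by (simp add: pmon_def polyfun_le_const)
next
  case (insert v I)
  have "M * k v \<le> M * N" using insert.prems by simp
  then have "(\<lambda>a. f v a ^ k v) \<in> polyfun_le T (M * N)"
    using polyfun_le_power[of "f v" T M "k v"] insert.prems(1)[of v] polyfun_le_mono by blast
  then have "(\<lambda>a. f v a ^ k v * pmon I k (\<lambda>v. f v a)) \<in> polyfun_le T (M * N + M * N * card I)"
    using insert by (intro polyfun_le_mult) auto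
  then show ?case using insert.hyps by (simp add: pmon_def)
qed

lemma polyfun_mult: "f \<in> polyfun T \<Longrightarrow> g \<in> polyfun T \<Longrightarrow> (\<lambda>a. f a * g a) \<in> polyfun T"
  unfolding polyfun_def using polyfun_le_mult by blast

lemma polyfun_add: "f \<in> polyfun T \<Longrightarrow> g \<in> polyfun T \<Longrightarrow> (\<lambda>a. f a + g a) \<in> polyfun T"
proof -
  assume "f \<in> polyfun T" "g \<in> polyfun T"
  then obtain M N where "f \<in> polyfun_le T M" "g \<in> polyfun_le T N" unfolding polyfun_def by auto
  then have "f \<in> polyfun_le T (max M N)" "g \<in> polyfun_le T (max M N)"
    using polyfun_le_mono[of M "max M N"] polyfun_le_mono[of N "max M N"] by auto
  then show ?thesis unfolding polyfun_def using polyfun_le_add by blast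
qed

lemma polyfun_const: "(\<lambda>a. c) \<in> polyfun T"
  unfolding polyfun_def using polyfun_le_const by blast

lemma polyfun_sum:
  "(\<And>i. i \<in> I \<Longrightarrow> f i \<in> polyfun T) \<Longrightarrow> (\<lambda>a. \<Sum>i\<in>I. f i a) \<in> polyfun T"
  by (induction I rule: infinite_finite_induct) (auto simp: polyfun_const intro: polyfun_add)

lemma polyfun_pmon: "finite T \<Longrightarrow> pmon T k \<in> polyfun T"
proof -
  assume "finite T"
  then have "\<And>v. v \<in> T \<Longrightarrow> k v \<le> Max (k ` T)" by simp
  then show ?thesis unfolding polyfun_def using pmon_in_polyfun_le by blast
qed

lemma polyfun_subst:
  assumes "f \<in> polyfun T" and T: "finite T" and g: "\<And>v. v \<in> T \<Longrightarrow> (\<lambda>a. g a v) \<in> polyfun T'"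
  shows "(\<lambda>a. f (g a)) \<in> polyfun T'"
proof -
  obtain M where "f \<in> polyfun_le T M" using assms(1) unfolding polyfun_def by auto
  then show ?thesis unfolding polyfun_le_def
  proof (induction rule: fs.span_induct_alt)
    case base
    show ?case by (simp add: polyfun_const)
  next
    case (step c m f)
    then obtain k where k: "m = pmon T k" by auto
    have pw: "(\<lambda>a. g a v ^ e) \<in> polyfun T'" if "v \<in> T" for v e
      using polyfun_le_power g[OF that] unfolding polyfun_def by blast
    have "(\<lambda>a. \<Prod>v\<in>I. g a v ^ k v) \<in> polyfun T'" if "finite I" "I \<subseteq> T" for I
      using that by (induction I) (auto simp: polyfun_const intro: polyfun_mult pw)
    then have "(\<lambda>a. pmon T k (g a)) \<in> polyfun T'" using T by (simp add: pmon_def)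
    then have "(\<lambda>a. c * m (g a) + f (g a)) \<in> polyfun T'"
      using k step(2) by (intro polyfun_add polyfun_mult[OF polyfun_const]) auto
    then show ?case by simp
  qed
qed

lemma polyfun_cong:
  assumes "f \<in> polyfun T" "\<And>v. v \<in> T \<Longrightarrow> a v = b v"
  shows "f a = f b"
proof -
  obtain M where "f \<in> polyfun_le T M" using assms(1) unfolding polyfun_def by auto
  then show ?thesis unfolding polyfun_le_def
  proof (induction rule: fs.span_induct_alt)
    case (step c m f)
    then have "m a = m b" using assms(2) by (auto simp: pmon_def intro!: prod.cong)
    then show ?case using step by simp
  qed simp
qed

text \<open>Induction on the variables: with the other coordinates fixed, the relation is a
  polynomial in \<open>a v\<close> vanishing everywhere, so each of its coefficients vanishes and is
  a relation in fewer variables.\<close>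

lemma pmon_linear_independent:
  assumes "finite T" "\<And>a. (\<Sum>k\<in>T \<rightarrow>\<^sub>E {..N}. c k * pmon T k a) = 0" "k \<in> T \<rightarrow>\<^sub>E {..N}"
  shows "c k = 0"
  using assms
proof (induction T arbitrary: c k)
  case empty
  then show ?case by (simp add: pmon_def)
next
  case (insert v T)
  let ?P = "T \<rightarrow>\<^sub>E {..N}"
  have fin: "finite ?P" using insert.hyps by (simp add: finite_PiE)
  have pmon_upd: "pmon (insert v T) (l(v := e)) a = a v ^ e * pmon T l a" for l e a
  proof -
    have "(\<Prod>x\<in>T. a x ^ (l(v := e)) x) = (\<Prod>x\<in>T. a x ^ l x)"
      using insert.hyps by (intro prod.cong) auto
    then show ?thesis using insert.hyps by (simp add: pmon_def)
  qed
  have split: "(\<Sum>k\<in>insert v T \<rightarrow>\<^sub>E {..N}. c k * pmon (insert v T) k a)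
      = (\<Sum>e\<le>N. (\<Sum>l\<in>?P. c (l(v := e)) * pmon T l a) * a v ^ e)" for a
  proof -
    have inj: "inj_on (\<lambda>(e, l). l(v := e)) ({..N} \<times> ?P)"
      using inj_combinator[of v T "\<lambda>_. {..N}"] insert.hyps by simp
    have "(\<Sum>k\<in>insert v T \<rightarrow>\<^sub>E {..N}. c k * pmon (insert v T) k a)
        = (\<Sum>(e, l)\<in>{..N} \<times> ?P. c (l(v := e)) * pmon (insert v T) (l(v := e)) a)"
      unfolding PiE_insert_eq by (subst sum.reindex[OF inj]) (simp add: case_prod_unfold)
    also have "\<dots> = (\<Sum>e\<le>N. \<Sum>l\<in>?P. c (l(v := e)) * (a v ^ e * pmon T l a))"
      by (simp only: pmon_upd sum.cartesian_product)
    finally show ?thesis by (simp add: sum_distrib_left sum_distrib_right mult_ac)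
  qed
  have coeff: "(\<Sum>l\<in>?P. c (l(v := e)) * pmon T l a) = 0" if "e \<le> N" for a e
  proof -
    have "(\<Sum>e\<le>N. (\<Sum>l\<in>?P. c (l(v := e)) * pmon T l a) * t ^ e) = 0" for t
    proof -
      have "pmon T l (a(v := t)) = pmon T l a" for l
        using insert.hyps by (auto simp: pmon_def intro!: prod.cong)
      then show ?thesis using split[of "a(v := t)"] insert.prems(1)[of "a(v := t)"] by simp
    qed
    then show ?thesis using polyfun_eq_0[of "\<lambda>e. \<Sum>l\<in>?P. c (l(v := e)) * pmon T l a" N] that by blast
  qed
  obtain e l where el: "k = l(v := e)" "e \<le> N" "l \<in> ?P"
    using insert.prems(2) unfolding PiE_insert_eq by auto
  show ?case unfolding el(1)
    using insert.IH[of "\<lambda>l. c (l(v := e))" l, OF coeff[OF el(2)] el(3)] .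
qed

text \<open>The two sides count exponent vectors: bounded by \<open>M * N * t\<close> in
  \<open>m\<close> parameters, and by \<open>N\<close> in \<open>t\<close> coordinates.\<close>

lemma power_exceeds:
  fixes M m t :: nat
  assumes "m < t"
  shows "\<exists>N. (M * N * t + 1) ^ m < (N + 1) ^ t"
proof
  \<comment> \<open>\<open>N\<close> is itself the constant factor to be beaten, so the one spare
    power of \<open>N + 1\<close> suffices.\<close>
  define N where "N = (M * t + 1) ^ m"
  have "M * N * t + 1 \<le> (M * t + 1) * (N + 1)" by (simp add: algebra_simps)
  then have "(M * N * t + 1) ^ m \<le> ((M * t + 1) * (N + 1)) ^ m" by (rule power_mono) simp
  also have "\<dots> = N * (N + 1) ^ m" by (simp only: power_mult_distrib N_def)
  also have "\<dots> < (N + 1) ^ Suc m" by simp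
  also have "\<dots> \<le> (N + 1) ^ t" using assms by (intro power_increasing) auto
  finally show "(M * N * t + 1) ^ m < (N + 1) ^ t" .
qed

text \<open>More coordinate functions than parameters are algebraically dependent, because there are
  more monomials of bounded degree in the former than in the latter.\<close>

lemma polyfun_dependent:
  assumes fin: "finite E" "finite T" and card: "card E < card T"
    and \<phi>: "\<And>v. v \<in> T \<Longrightarrow> (\<lambda>x. \<phi> x v) \<in> polyfun_le E M"
  shows "\<exists>g\<in>polyfun T. (\<exists>a. g a \<noteq> 0) \<and> (\<forall>x. g (\<phi> x) = 0)"
proof -
  obtain N where N: "(M * N * card T + 1) ^ card E < (N + 1) ^ card T"
    using power_exceeds[OF card] by blast
  define K where "K = T \<rightarrow>\<^sub>E {..N}"
  define \<Psi> where "\<Psi> k x = pmon T k (\<phi> x)" for k x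
  have K: "finite K" "card K = (N + 1) ^ card T"
    using fin by (auto simp: K_def finite_PiE card_PiE)
  define D where "D = pmon E ` (E \<rightarrow>\<^sub>E {..M * N * card T})"
  have finD: "finite D" using fin by (simp add: D_def finite_PiE)
  have "card D \<le> card (E \<rightarrow>\<^sub>E {..M * N * card T})"
    unfolding D_def using fin by (intro card_image_le finite_PiE) auto
  also have "\<dots> = (M * N * card T + 1) ^ card E" using fin by (simp add: card_PiE)
  finally have cardD: "card D < card K" using N K by simp
  have sub: "\<Psi> ` K \<subseteq> fs.span D"
  proof
    fix h assume "h \<in> \<Psi> ` K"
    then obtain k where k: "k \<in> K" "h = \<Psi> k" by auto
    have "(\<lambda>x. pmon T k (\<phi> x)) \<in> polyfun_le E (M * N * card T)"
      using polyfun_le_pmon[of T "\<lambda>v x. \<phi> x v" E M k N] fin \<phi> k(1)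
      by (auto simp: K_def PiE_iff)
    then show "h \<in> fs.span D" using k(2) by (simp add: \<Psi>_def[abs_def] polyfun_le_def D_def)
  qed
  have "\<exists>c. (\<exists>k\<in>K. c k \<noteq> 0) \<and> (\<forall>x. (\<Sum>k\<in>K. c k * \<Psi> k x) = 0)"
  \<comment> \<open>Linear dependence is stated for sets of functions. If \<open>\<Psi>\<close>
    identifies two monomials, their difference is already a relation.\<close>
  proof (cases "inj_on \<Psi> K")
    case True
    then have "card (\<Psi> ` K) = card K" by (rule card_image)
    then have "fs.dependent (\<Psi> ` K)"
      using fs.independent_span_bound[OF finD _ sub] cardD by auto
    then obtain u where u: "\<exists>h\<in>\<Psi> ` K. u h \<noteq> 0" "(\<Sum>h\<in>\<Psi> ` K. (\<lambda>x. u h * h x)) = 0"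
      using fs.dependent_finite[of "\<Psi> ` K"] K by auto
    have "(\<Sum>k\<in>K. u (\<Psi> k) * \<Psi> k x) = 0" for x
      using fun_cong[OF u(2), of x] by (simp add: sum_fun_apply sum.reindex[OF True])
    then show ?thesis using u(1) by (intro exI[of _ "\<lambda>k. u (\<Psi> k)"]) auto
  next
    case False
    then obtain k l where kl: "k \<in> K" "l \<in> K" "k \<noteq> l" "\<Psi> k = \<Psi> l" unfolding inj_on_def by auto
    define c :: "(nat \<times> nat \<Rightarrow> nat) \<Rightarrow> complex" where
      "c j = (if j = k then 1 else if j = l then -1 else 0)" for j
    have "(\<Sum>j\<in>K. c j * \<Psi> j x) = 0" for x
    proof -
      have "(\<Sum>j\<in>K. c j * \<Psi> j x) = (\<Sum>j\<in>{k, l}. c j * \<Psi> j x)"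
        using K kl by (intro sum.mono_neutral_right) (auto simp: c_def)
      then show ?thesis using kl by (simp add: c_def)
    qed
    then show ?thesis using kl by (intro exI[of _ c]) (auto simp: c_def)
  qed
  then obtain c where c: "\<exists>k\<in>K. c k \<noteq> 0" "\<And>x. (\<Sum>k\<in>K. c k * \<Psi> k x) = 0" by blast
  define g where "g a = (\<Sum>k\<in>K. c k * pmon T k a)" for a
  have "g \<in> polyfun T" unfolding g_def[abs_def]
    using fin by (intro polyfun_sum polyfun_mult[OF polyfun_const] polyfun_pmon)
  moreover have "\<exists>a. g a \<noteq> 0"
  proof (rule ccontr)
    assume none: "\<nexists>a. g a \<noteq> 0"
    have "c k = 0" if "k \<in> K" for k
    proof (rule pmon_linear_independent[OF fin(2)])
      show "(\<Sum>k\<in>T \<rightarrow>\<^sub>E {..N}. c k * pmon T k a) = 0" for a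
        using none unfolding K_def[symmetric] g_def[symmetric] by blast
      show "k \<in> T \<rightarrow>\<^sub>E {..N}" using that unfolding K_def .
    qed
    then show False using c(1) by blast
  qed
  ultimately show ?thesis
    using c(2) unfolding \<Psi>_def by (intro bexI[of _ g]) (auto simp: g_def)
qed

section \<open>Formal polynomials and the functions they define\<close>

lemma peval_superset:
  assumes "finite K" "Poly_Mapping.keys p \<subseteq> K"
  shows "peval p a = (\<Sum>m\<in>K. Poly_Mapping.lookup p m *
     (\<Prod>v \<in> Poly_Mapping.keys m. a v ^ Poly_Mapping.lookup m v))"
  unfolding peval_def using assms by (intro sum.mono_neutral_left) (auto simp: in_keys_iff)

lemma peval_add: "peval (p + q) a = peval p a + peval q a"
proof -
  let ?K = "Poly_Mapping.keys p \<union> Poly_Mapping.keys q"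
  have "Poly_Mapping.keys (p + q) \<subseteq> ?K" by (rule Poly_Mapping.keys_add)
  then show ?thesis
    using peval_superset[of ?K p a] peval_superset[of ?K q a] peval_superset[of ?K "p + q" a]
    by (simp add: lookup_add distrib_right sum.distrib)
qed

lemma pvars_add: "pvars (p + q) \<subseteq> pvars p \<union> pvars q"
  unfolding pvars_def using Poly_Mapping.keys_add[of p q] by blast

lemma monomial_eq_pmon:
  assumes "finite T" "Poly_Mapping.keys m \<subseteq> T"
  shows "(\<Prod>v \<in> Poly_Mapping.keys m. a v ^ Poly_Mapping.lookup m v) = pmon T (Poly_Mapping.lookup m) a"
  unfolding pmon_def using assms by (intro prod.mono_neutral_left) (auto simp: in_keys_iff)

lemma peval_in_polyfun:
  assumes "finite T" "pvars p \<subseteq> T"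
  shows "peval p \<in> polyfun T"
proof -
  have "peval p = (\<lambda>a. \<Sum>m\<in>Poly_Mapping.keys p. Poly_Mapping.lookup p m * pmon T (Poly_Mapping.lookup m) a)"
    unfolding peval_def using assms
    by (intro ext sum.cong refl arg_cong2[of _ _ _ _ "(*)"] monomial_eq_pmon) (auto simp: pvars_def)
  then show ?thesis
    using assms(1) by (simp only:) (intro polyfun_sum polyfun_mult[OF polyfun_const] polyfun_pmon)
qed

lemma polyfun_peval:
  assumes "finite T" "f \<in> polyfun T"
  obtains p where "pvars p \<subseteq> T" "peval p = f"
proof -
  obtain M where "f \<in> polyfun_le T M" using assms(2) unfolding polyfun_def by auto
  then have "\<exists>p. pvars p \<subseteq> T \<and> peval p = f" unfolding polyfun_le_def
  proof (induction rule: fs.span_induct_alt)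
    case base
    show ?case by (intro exI[of _ 0]) (auto simp: pvars_def peval_def fun_eq_iff)
  next
    case (step c g f)
    then obtain k p where k: "g = pmon T k" and p: "pvars p \<subseteq> T" "peval p = f" by auto
    define m where "m = Abs_poly_mapping (\<lambda>v. if v \<in> T then k v else 0)"
    have m: "Poly_Mapping.lookup m = (\<lambda>v. if v \<in> T then k v else 0)"
      unfolding m_def using assms(1) by (intro lookup_Abs_poly_mapping) (auto elim: rev_finite_subset)
    then have km: "Poly_Mapping.keys m \<subseteq> T" by (auto simp: in_keys_iff split: if_splits)
    have "peval (Poly_Mapping.single m c) a = c * pmon T k a" for a
    proof -
      have "peval (Poly_Mapping.single m c) a
          = c * (\<Prod>v \<in> Poly_Mapping.keys m. a v ^ Poly_Mapping.lookup m v)"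
        using peval_superset[of "{m}" "Poly_Mapping.single m c" a] by simp
      also have "\<dots> = c * pmon T (Poly_Mapping.lookup m) a"
        using monomial_eq_pmon[OF assms(1) km] by simp
      also have "pmon T (Poly_Mapping.lookup m) a = pmon T k a"
        unfolding pmon_def m by (intro prod.cong) auto
      finally show ?thesis .
    qed
    moreover have "pvars (Poly_Mapping.single m c) \<subseteq> T"
      using km by (auto simp: pvars_def split: if_splits)
    ultimately show ?case using p k pvars_add[of "Poly_Mapping.single m c" p]
      by (intro exI[of _ "Poly_Mapping.single m c + p"]) (auto simp: peval_add fun_eq_iff)
  qed
  then show ?thesis using that by blast
qed

text \<open>The Zariski closure is proper, witnessed by one equation. The non-root may be any point,
  since functions in \<open>polyfun T\<close> read only the coordinates in \<open>T\<close>.\<close>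

definition nondense :: "(nat \<times> nat) set \<Rightarrow> point set \<Rightarrow> bool" where
  "nondense T A \<longleftrightarrow> (\<exists>g\<in>polyfun T. (\<exists>a. g a \<noteq> 0) \<and> (\<forall>a\<in>A. g a = 0))"

lemma nondenseI: "g \<in> polyfun T \<Longrightarrow> g a \<noteq> 0 \<Longrightarrow> (\<And>x. x \<in> A \<Longrightarrow> g x = 0) \<Longrightarrow> nondense T A"
  unfolding nondense_def by (intro bexI[of _ g] conjI exI[of _ a]) auto

lemma nondenseE:
  assumes "nondense T A"
  obtains g a where "g \<in> polyfun T" "g a \<noteq> 0" "\<forall>x\<in>A. g x = 0"
  using assms unfolding nondense_def by auto

lemma nondense_subset: "nondense T B \<Longrightarrow> A \<subseteq> B \<Longrightarrow> nondense T A"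
  unfolding nondense_def by blast

lemma nondense_empty: "nondense T {}"
  unfolding nondense_def by (rule bexI[OF _ polyfun_const[of 1 T]]) simp

text \<open>Two nonzero polynomial functions have a common non-root, on the line joining non-roots of
  each.\<close>

lemma polyfun_along_line:
  assumes "f \<in> polyfun T"
  shows "\<exists>p. \<forall>t. f (\<lambda>v. a v + t * b v) = poly p t"
proof -
  obtain M where "f \<in> polyfun_le T M" using assms(1) unfolding polyfun_def by auto
  then show ?thesis unfolding polyfun_le_def
  proof (induction rule: fs.span_induct_alt)
    case base
    show ?case by (intro exI[of _ 0]) simp
  next
    case (step c m f)
    then obtain k p where k: "m = pmon T k" and p: "\<forall>t. f (\<lambda>v. a v + t * b v) = poly p t" by auto
    show ?case
      using k p by (intro exI[of _ "Polynomial.smult c (\<Prod>v\<in>T. [:a v, b v:] ^ k v) + p"])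
        (simp add: pmon_def poly_prod)
  qed
qed

text \<open>This is the irreducibility of affine space; it allows the exceptional sets of several
  steps to be collected into one.\<close>

lemma nondense_Un:
  assumes "nondense T A" "nondense T B"
  shows "nondense T (A \<union> B)"
proof -
  obtain f a where f: "f \<in> polyfun T" "f a \<noteq> 0" "\<forall>x\<in>A. f x = 0"
    by (rule nondenseE[OF assms(1)])
  obtain g b where g: "g \<in> polyfun T" "g b \<noteq> 0" "\<forall>x\<in>B. g x = 0"
    by (rule nondenseE[OF assms(2)])
  let ?l = "\<lambda>t v. a v + t * (b v - a v)"
  obtain p where p: "\<And>t. f (?l t) = poly p t" using polyfun_along_line[OF f(1), of a "\<lambda>v. b v - a v"] by blast
  obtain q where q: "\<And>t. g (?l t) = poly q t" using polyfun_along_line[OF g(1), of a "\<lambda>v. b v - a v"] by blast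
  have "p \<noteq> 0" using p[of 0] f(2) by auto
  moreover have "q \<noteq> 0" using q[of 1] g(2) by auto
  ultimately have "p * q \<noteq> 0" by simp
  then obtain t where "poly (p * q) t \<noteq> 0" using poly_all_0_iff_0 by blast
  then have "f (?l t) * g (?l t) \<noteq> 0" by (simp add: p q)
  with polyfun_mult[OF f(1) g(1)] show ?thesis
    by (rule nondenseI) (use f(3) g(3) in auto)
qed

lemma nondense_UN: "finite I \<Longrightarrow> (\<And>i. i \<in> I \<Longrightarrow> nondense T (A i)) \<Longrightarrow> nondense T (\<Union>i\<in>I. A i)"
  by (induction I rule: finite_induct) (auto intro: nondense_empty nondense_Un)

lemma polyfun_restrict: "f \<in> polyfun T \<Longrightarrow> f (restrict a T) = f a"
  using polyfun_cong[of f T "restrict a T" a] by auto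

lemma restrict_in_aff: "restrict a T \<in> aff T"
  by (auto simp: aff_def)

lemma nondense_iff_closed:
  assumes "finite T" "A \<subseteq> aff T"
  shows "nondense T A \<longleftrightarrow> (\<exists>C. zariski_closed T C \<and> C \<noteq> aff T \<and> A \<subseteq> C)"
proof
  assume "nondense T A"
  then obtain g a where g: "g \<in> polyfun T" "g a \<noteq> 0" "\<forall>x\<in>A. g x = 0"
    by (rule nondenseE)
  obtain p where p: "pvars p \<subseteq> T" "peval p = g" using polyfun_peval[OF assms(1) g(1)] .
  let ?C = "{a \<in> aff T. \<forall>p\<in>{p}. peval p a = 0}"
  have "zariski_closed T ?C" unfolding zariski_closed_def using p(1) by blast
  moreover have "restrict a T \<notin> ?C" using g p polyfun_restrict[OF g(1)] by simp
  then have "?C \<noteq> aff T" using restrict_in_aff by blast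
  moreover have "A \<subseteq> ?C" using g(3) p(2) assms(2) by auto
  ultimately show "\<exists>C. zariski_closed T C \<and> C \<noteq> aff T \<and> A \<subseteq> C" by blast
next
  assume "\<exists>C. zariski_closed T C \<and> C \<noteq> aff T \<and> A \<subseteq> C"
  then obtain C where C: "zariski_closed T C" "C \<noteq> aff T" "A \<subseteq> C" by blast
  then obtain I where I: "\<forall>p\<in>I. pvars p \<subseteq> T" "C = {a \<in> aff T. \<forall>p\<in>I. peval p a = 0}"
    unfolding zariski_closed_def by blast
  then obtain a p where "a \<in> aff T" "p \<in> I" "peval p a \<noteq> 0" using C(2) by blast
  then show "nondense T A" unfolding nondense_def
    using I C(3) peval_in_polyfun[OF assms(1), of p] by (intro bexI[of _ "peval p"]) auto
qed

section \<open>Dominance and generic fibres in terms of non-dense sets\<close>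

lemma proj_dominant_iff:
  "finite T \<Longrightarrow> proj_dominant X T \<longleftrightarrow> \<not> nondense T ((\<lambda>a. restrict a T) ` X)"
  by (subst nondense_iff_closed) (auto simp: proj_dominant_def restrict_in_aff)

text \<open>A property that holds outside \<open>A\<close> also holds outside a closed set
  containing \<open>A\<close>. Exceptional sets may thus be projections or slices, which are not
  closed in general.\<close>

lemma generic_fibre_iff:
  assumes "finite T"
  shows "(\<exists>C. zariski_closed T C \<and> C \<noteq> aff T \<and> (\<forall>b \<in> aff T - C. P b))
    \<longleftrightarrow> (\<exists>A\<subseteq>aff T. nondense T A \<and> (\<forall>b \<in> aff T - A. P b))"
proof
  assume "\<exists>C. zariski_closed T C \<and> C \<noteq> aff T \<and> (\<forall>b \<in> aff T - C. P b)"
  then obtain C where C: "zariski_closed T C" "C \<noteq> aff T" "\<forall>b \<in> aff T - C. P b" by blast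
  have "C \<subseteq> aff T" using C(1) unfolding zariski_closed_def by blast
  then show "\<exists>A\<subseteq>aff T. nondense T A \<and> (\<forall>b \<in> aff T - A. P b)"
    using nondense_iff_closed[OF assms] C by blast
next
  assume "\<exists>A\<subseteq>aff T. nondense T A \<and> (\<forall>b \<in> aff T - A. P b)"
  then obtain A where A: "A \<subseteq> aff T" "nondense T A" "\<forall>b \<in> aff T - A. P b" by blast
  obtain C where "zariski_closed T C" "C \<noteq> aff T" "A \<subseteq> C"
    using nondense_iff_closed[OF assms A(1)] A(2) by blast
  then show "\<exists>C. zariski_closed T C \<and> C \<noteq> aff T \<and> (\<forall>b \<in> aff T - C. P b)"
    using A(3) by blast
qed

text \<open>Agreement of the two predicates for every \<open>d\<close> makes the two
  \<open>THE\<close> terms equal.\<close>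

lemma proj_degree_eqI:
  assumes fin: "finite T" "finite T'"
    and dom: "nondense T ((\<lambda>a. restrict a T) ` X) \<longleftrightarrow> nondense T' ((\<lambda>a. restrict a T') ` X')"
    and deg: "\<And>d. (\<exists>A\<subseteq>aff T. nondense T A \<and> (\<forall>b \<in> aff T - A.
          finite {a \<in> X. restrict a T = b} \<and> card {a \<in> X. restrict a T = b} = d))
      \<longleftrightarrow> (\<exists>A\<subseteq>aff T'. nondense T' A \<and> (\<forall>b \<in> aff T' - A.
          finite {a \<in> X'. restrict a T' = b} \<and> card {a \<in> X'. restrict a T' = b} = d))"
  shows "proj_degree X T = proj_degree X' T'"
  unfolding proj_degree_def proj_dominant_iff[OF fin(1)] proj_dominant_iff[OF fin(2)]
    generic_fibre_iff[OF fin(1)] generic_fibre_iff[OF fin(2)] dom deg ..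

text \<open>A polynomial stays nonzero on the slice through one of its non-roots \<open>a\<close>,
  so \<open>t\<close> is taken to be \<open>a e\<close>.\<close>

lemma nondense_slice:
  assumes "finite T" "e \<notin> T" "nondense (insert e T) A"
  shows "\<exists>t. nondense T {b \<in> aff T. b(e := t) \<in> A}"
proof -
  obtain g a where g: "g \<in> polyfun (insert e T)" "g a \<noteq> 0" "\<forall>x\<in>A. g x = 0"
    by (rule nondenseE[OF assms(3)])
  have "(\<lambda>b. g (b(e := a e))) \<in> polyfun T"
  proof (rule polyfun_subst[OF g(1)])
    fix v assume v: "v \<in> insert e T"
    show "(\<lambda>b. (b(e := a e)) v) \<in> polyfun T"
    proof (cases "v = e")
      case True
      then show ?thesis by (simp add: polyfun_const)
    next
      case False
      then have "(\<lambda>b. b v) \<in> polyfun T" using polyfun_le_var assms(1) v unfolding polyfun_def by blast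
      then show ?thesis using False by simp
    qed
  qed (use assms in auto)
  moreover have "g (a(e := a e)) \<noteq> 0" using g(2) by simp
  ultimately have "nondense T {b \<in> aff T. b(e := a e) \<in> A}"
    by (rule nondenseI) (use g(3) in \<open>auto simp del: fun_upd_apply\<close>)
  then show ?thesis by blast
qed

lemma nondense_cylinder:
  assumes "finite T" "T \<subseteq> T'" "finite T'" "nondense T A"
  shows "nondense T' {b \<in> aff T'. restrict b T \<in> A}"
proof -
  obtain g a where g: "g \<in> polyfun T" "g a \<noteq> 0" "\<forall>x\<in>A. g x = 0"
    by (rule nondenseE[OF assms(4)])
  have "g \<in> polyfun T'"
    using polyfun_subst[OF g(1) assms(1), of "\<lambda>a. a" T'] polyfun_le_var assms(2,3)
    unfolding polyfun_def by blast
  moreover have "g b = 0" if "restrict b T \<in> A" for b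
    using g(3) that polyfun_restrict[OF g(1), of b] by auto
  ultimately show ?thesis using g(2) by (intro nondenseI[of g T' a]) auto
qed

lemma nondense_image:
  assumes fin: "finite E" "finite T" and card: "card E < card T"
    and \<phi>: "\<And>v. v \<in> T \<Longrightarrow> (\<lambda>x. \<phi> x v) \<in> polyfun E"
  shows "nondense T (range (\<lambda>x. restrict (\<phi> x) T))"
proof -
  have "\<forall>v\<in>T. \<exists>M. (\<lambda>x. \<phi> x v) \<in> polyfun_le E M" using \<phi> unfolding polyfun_def by blast
  then obtain M where M: "\<And>v. v \<in> T \<Longrightarrow> (\<lambda>x. \<phi> x v) \<in> polyfun_le E (M v)" by metis
  have "(\<lambda>x. \<phi> x v) \<in> polyfun_le E (Max (M ` T))" if "v \<in> T" for v
    using M[OF that] polyfun_le_mono[of "M v" "Max (M ` T)"] fin(2) that by auto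
  then obtain g where "g \<in> polyfun T" "\<exists>a. g a \<noteq> 0" "\<forall>x. g (\<phi> x) = 0"
    using polyfun_dependent[OF fin card, of \<phi> "Max (M ` T)"] by blast
  then show ?thesis unfolding nondense_def by (intro bexI[of _ g]) (auto simp: polyfun_restrict)
qed

section \<open>Diagrams and Bruhat order\<close>

text \<open>The value \<open>n + 1\<close> stands for a row without a dot.\<close>

definition placement :: "nat \<Rightarrow> (nat \<Rightarrow> nat) \<Rightarrow> bool" where
  "placement n f \<longleftrightarrow> f ` {1..n} \<subseteq> {1..n + 1} \<and>
     inj_on f {i \<in> {1..n}. f i \<le> n}"

definition dots :: "(nat \<Rightarrow> nat) \<Rightarrow> nat \<Rightarrow> nat \<Rightarrow> nat" where
  "dots f p q = card {i \<in> {1..p}. f i \<le> q}"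

text \<open>The Rothe diagram, phrased without an inverse because a placement may leave columns
  without a dot.\<close>

definition diagram :: "nat \<Rightarrow> (nat \<Rightarrow> nat) \<Rightarrow> (nat \<times> nat) set" where
  "diagram n f = {(i, j) \<in> grid n. j < f i \<and> (\<forall>i'\<in>{1..<i}. f i' \<noteq> j)}"

definition noninv :: "nat \<Rightarrow> (nat \<Rightarrow> nat) \<Rightarrow> (nat \<times> nat) set" where
  "noninv n f = {(i', i). i' \<in> {1..<i} \<and> i \<in> {1..n} \<and> f i' < f i}"

lemma placementD:
  assumes f: "placement n f" and i: "i \<in> {1..n}"
  shows "1 \<le> f i \<and> f i \<le> n + 1"
    and "i' \<in> {1..n} \<Longrightarrow> f i = f i' \<Longrightarrow> f i \<le> n \<Longrightarrow> i = i'"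
proof -
  have "f i \<in> {1..n + 1}" using f i unfolding placement_def by (meson imageI subsetD)
  then show "1 \<le> f i \<and> f i \<le> n + 1" by simp
  assume "i' \<in> {1..n}" "f i = f i'" "f i \<le> n"
  then show "i = i'" using f i unfolding placement_def by (auto dest: inj_onD)
qed

lemma placementI:
  assumes "\<And>i. i \<in> {1..n} \<Longrightarrow> f i \<in> {1..n + 1}"
    and "\<And>i i'. i \<in> {1..n} \<Longrightarrow> i' \<in> {1..n} \<Longrightarrow> f i = f i' \<Longrightarrow> f i \<le> n \<Longrightarrow> i = i'"
  shows "placement n f"
  unfolding placement_def using assms by (auto intro!: inj_onI)

lemma finite_grid [simp]: "finite (grid n)"
  by (simp add: grid_def)

lemma card_grid [simp]: "card (grid n) = n * n"
  by (simp add: grid_def)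

lemma finite_noninv [simp]: "finite (noninv n f)"
  by (rule finite_subset[of _ "{1..n} \<times> {1..n}"]) (auto simp: noninv_def)

lemma diagram_subset: "diagram n f \<subseteq> grid n"
  by (auto simp: diagram_def)

lemma finite_diagram [simp]: "finite (diagram n f)"
  using diagram_subset finite_grid by (rule finite_subset)

lemma card_diagram_le: "card (diagram n f) \<le> n * n"
  using card_mono[OF finite_grid diagram_subset] by simp

text \<open>Row \<open>i\<close> has \<open>f i - 1\<close> cells left of its dot. Those outside the
  diagram lie below an earlier dot, and the cell \<open>(i, f i')\<close> corresponds to the
  noninversion \<open>(i', i)\<close>.\<close>

lemma card_diagram_noninv:
  assumes "placement n f"
  shows "card (diagram n f) + card (noninv n f) = (\<Sum>i\<in>{1..n}. f i - 1)"
proof -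
  define H where "H = {(i, j) \<in> grid n. j < f i \<and> (\<exists>i'\<in>{1..<i}. f i' = j)}"
  have "finite H" by (rule finite_subset[OF _ finite_grid[of n]]) (auto simp: H_def)
  have "bij_betw (\<lambda>(i', i). (i, f i')) (noninv n f) H"
    unfolding bij_betw_def
  proof
    show "inj_on (\<lambda>(i', i). (i, f i')) (noninv n f)"
    proof (rule inj_onI, clarify)
      fix i' i k' assume a: "(i', i) \<in> noninv n f" "(k', i) \<in> noninv n f" "f i' = f k'"
      then have "f i' \<le> n" using placementD(1)[OF assms, of i] by (auto simp: noninv_def)
      then show "i' = k' \<and> i = i" using a placementD(2)[OF assms, of i' k'] by (auto simp: noninv_def)
    qed
    show "(\<lambda>(i', i). (i, f i')) ` noninv n f = H"
    proof (intro equalityI subsetI)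
      fix x assume "x \<in> (\<lambda>(i', i). (i, f i')) ` noninv n f"
      then obtain i' i where x: "x = (i, f i')" "i' \<in> {1..<i}" "i \<in> {1..n}" "f i' < f i"
        by (auto simp: noninv_def)
      then show "x \<in> H"
        using placementD(1)[OF assms, of i'] placementD(1)[OF assms, of i] by (auto simp: H_def grid_def)
    next
      fix x assume "x \<in> H"
      then obtain i i' where "x = (i, f i')" "i \<in> {1..n}" "f i' < f i" "i' \<in> {1..<i}"
        by (auto simp: H_def grid_def)
      then show "x \<in> (\<lambda>(i', i). (i, f i')) ` noninv n f"
        by (intro image_eqI[of _ _ "(i', i)"]) (auto simp: noninv_def)
    qed
  qed
  then have "card (noninv n f) = card H" by (rule bij_betw_same_card)
  moreover have "card (diagram n f) + card H = card (diagram n f \<union> H)"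
    by (rule card_Un_disjoint[OF finite_diagram \<open>finite H\<close>, symmetric]) (auto simp: diagram_def H_def)
  moreover have "diagram n f \<union> H = (SIGMA i:{1..n}. {1..<f i})"
    using placementD(1)[OF assms] by (fastforce simp: diagram_def H_def grid_def)
  ultimately show ?thesis by simp
qed

text \<open>No row between \<open>i0\<close> and \<open>i1\<close> has its value between
  \<open>v i0\<close> and \<open>v i1\<close>, so \<open>(i0, i1)\<close> is the only noninversion
  lost once the remaining pairs are matched suitably.\<close>

lemma card_noninv_swap:
  assumes "1 \<le> i0" "i0 < i1" "i1 \<le> n" and lt: "v i0 < v i1"
    and mid: "\<And>i. i0 < i \<Longrightarrow> i < i1 \<Longrightarrow> v i < v i0 \<or> v i1 < v i"
  shows "card (noninv n v) = card (noninv n (v \<circ> Transposition.transpose i0 i1)) + 1"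
proof -
  let ?t = "Transposition.transpose i0 i1"
  \<comment> \<open>A pair reaching outside \<open>{i0..i1}\<close> keeps its order when both
    entries are moved by \<open>?t\<close>. A pair inside is left in place, since moving it could
    reverse the order of its positions.\<close>
  define \<phi> where "\<phi> = (\<lambda>(i', i). if i' < i0 \<or> i1 < i then (?t i', ?t i) else (i', i))"
  define Q where "Q = {(i', i). 1 \<le> i' \<and> i' < i \<and> i \<le> n}"
  have t: "?t i0 = i1" "?t i1 = i0" "\<And>i. i \<noteq> i0 \<Longrightarrow> i \<noteq> i1 \<Longrightarrow> ?t i = i"
    by (auto simp: transpose_def)
  have \<phi>Q: "\<phi> x \<in> Q \<and> \<phi> (\<phi> x) = x" if xQ: "x \<in> Q" for x
  proof -
    obtain i' i where x: "x = (i', i)" by (cases x)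
    consider "i' < i0" | "i1 < i" "i0 \<le> i'" | "i0 \<le> i'" "i \<le> i1" by linarith
    then show ?thesis
    proof cases
      case 1
      then have "?t i' = i'" using assms(2) by (intro t(3)) auto
      then show ?thesis using 1 x xQ assms
        by (cases "i = i0"; cases "i = i1") (auto simp: \<phi>_def Q_def t)
    next
      case 2
      then have "?t i = i" using assms(2) by (intro t(3)) auto
      then show ?thesis using 2 x xQ assms
        by (cases "i' = i0"; cases "i' = i1") (auto simp: \<phi>_def Q_def t)
    next
      case 3
      then show ?thesis using x xQ by (auto simp: \<phi>_def)
    qed
  qed
  have iff: "x \<in> noninv n v \<longleftrightarrow> \<phi> x \<in> noninv n (v \<circ> ?t)" if xQ: "x \<in> Q" and ne: "x \<noteq> (i0, i1)" for x
  proof -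
    obtain i' i where x: "x = (i', i)" by (cases x)
    have N: "y \<in> noninv n h \<longleftrightarrow> h (fst y) < h (snd y)" if "y \<in> Q" for y and h :: "nat \<Rightarrow> nat"
      using that by (auto simp: noninv_def Q_def)
    show ?thesis
    proof (cases "i' < i0 \<or> i1 < i")
      case True
      then show ?thesis using x N[OF xQ] N[of "\<phi> x"] \<phi>Q[OF xQ] by (simp add: \<phi>_def)
    next
      case False
      then have "\<phi> x = x" using x by (simp add: \<phi>_def)
      moreover have "v i' < v i \<longleftrightarrow> v (?t i') < v (?t i)"
      proof -
        have "i' < i" using x xQ by (auto simp: Q_def)
        consider "i' = i0" "i0 < i" "i < i1" | "i0 < i'" "i' < i1" "i = i1" | "i0 < i'" "i < i1"
          using False \<open>i' < i\<close> ne x by fastforce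
        then show ?thesis
        proof cases
          case 1
          then show ?thesis using mid[of i] lt t by auto
        next
          case 2
          then show ?thesis using mid[of i'] lt t by auto
        next
          case 3
          then show ?thesis using t(3) \<open>i' < i\<close> by auto
        qed
      qed
      ultimately show ?thesis using x N[OF xQ] by simp
    qed
  qed
  have \<phi>01: "\<phi> (i0, i1) = (i0, i1)" by (simp add: \<phi>_def)
  have sub: "noninv n h \<subseteq> Q" for h by (auto simp: noninv_def Q_def)
  have n01: "(i0, i1) \<notin> noninv n (v \<circ> ?t)" using lt t by (auto simp: noninv_def)
  have "bij_betw \<phi> (noninv n v - {(i0, i1)}) (noninv n (v \<circ> ?t))"
  proof (rule bij_betw_byWitness[where f' = \<phi>])
    show "\<phi> ` (noninv n v - {(i0, i1)}) \<subseteq> noninv n (v \<circ> ?t)" using iff sub by blast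
    show "\<phi> ` noninv n (v \<circ> ?t) \<subseteq> noninv n v - {(i0, i1)}"
    proof
      fix y assume "y \<in> \<phi> ` noninv n (v \<circ> ?t)"
      then obtain x where x: "x \<in> noninv n (v \<circ> ?t)" "y = \<phi> x" by auto
      then have "x \<in> Q" "x \<noteq> (i0, i1)" using sub n01 by auto
      then have y: "y \<in> Q" "\<phi> y = x" using \<phi>Q x(2) by auto
      then have "y \<noteq> (i0, i1)" using \<open>x \<noteq> (i0, i1)\<close> \<phi>01 by auto
      then show "y \<in> noninv n v - {(i0, i1)}" using iff[OF y(1)] y(2) x(1) by auto
    qed
  qed (use \<phi>Q sub in blast)+
  then have "card (noninv n v - {(i0, i1)}) = card (noninv n (v \<circ> ?t))" by (rule bij_betw_same_card)
  moreover have "(i0, i1) \<in> noninv n v" using assms by (auto simp: noninv_def)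
  ultimately show ?thesis using card_Suc_Diff1[OF finite_noninv] by (metis Suc_eq_plus1)
qed

lemma placement_swap:
  assumes "placement n v" "i0 \<in> {1..n}" "i1 \<in> {1..n}"
  shows "placement n (v \<circ> Transposition.transpose i0 i1)"
proof -
  have p: "Transposition.transpose i0 i1 permutes {1..n}" using assms by (simp add: permutes_swap_id)
  show ?thesis
  proof (rule placementI)
    fix i assume i: "i \<in> {1..n}"
    then have ti: "Transposition.transpose i0 i1 i \<in> {1..n}" using permutes_in_image[OF p] by blast
    then show "(v \<circ> Transposition.transpose i0 i1) i \<in> {1..n + 1}" using placementD(1)[OF assms(1)] by simp
    fix i' assume i': "i' \<in> {1..n}" "(v \<circ> Transposition.transpose i0 i1) i = (v \<circ> Transposition.transpose i0 i1) i'"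
      "(v \<circ> Transposition.transpose i0 i1) i \<le> n"
    then have "Transposition.transpose i0 i1 i' \<in> {1..n}" using permutes_in_image[OF p] by blast
    then have "Transposition.transpose i0 i1 i = Transposition.transpose i0 i1 i'"
      using placementD(2)[OF assms(1) ti] i' by simp
    then show "i = i'" by (metis transpose_involutory)
  qed
qed

text \<open>A swap preserves the sum of the row lengths \<open>v i - 1\<close>, so the lost
  noninversion becomes a box.\<close>

lemma card_diagram_swap:
  assumes v: "placement n v" and "1 \<le> i0" "i0 < i1" "i1 \<le> n" "v i0 < v i1"
    and "\<And>i. i0 < i \<Longrightarrow> i < i1 \<Longrightarrow> v i < v i0 \<or> v i1 < v i"
  shows "card (diagram n (v \<circ> Transposition.transpose i0 i1)) = card (diagram n v) + 1"
proof -
  have p: "Transposition.transpose i0 i1 permutes {1..n}" using assms by (simp add: permutes_swap_id)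
  have "(\<Sum>i\<in>{1..n}. (v \<circ> Transposition.transpose i0 i1) i - 1) = (\<Sum>i\<in>{1..n}. v i - 1)"
    using sum.permute[OF p, of "\<lambda>i. v i - 1"] by (simp add: o_def)
  moreover have "placement n (v \<circ> Transposition.transpose i0 i1)" using assms by (intro placement_swap) auto
  ultimately show ?thesis
    using card_diagram_noninv[OF v] card_diagram_noninv[of n "v \<circ> Transposition.transpose i0 i1"]
      card_noninv_swap[of i0 i1 n v] assms by simp
qed

text \<open>The row sum gains \<open>b - v i0\<close>, while new noninversions come only from
  earlier rows whose distinct values lie strictly between \<open>v i0\<close> and \<open>b\<close>;
  there are at most \<open>b - v i0 - 1\<close> of them.\<close>

lemma card_diagram_raise:
  assumes v: "placement n v" and i0: "i0 \<in> {1..n}" and ab: "v i0 < b" "b \<le> n + 1"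
    and later: "\<And>i. i0 < i \<Longrightarrow> i \<le> n \<Longrightarrow> v i \<le> v i0 \<or> b < v i"
    and vb: "placement n (v(i0 := b))"
  shows "card (diagram n v) < card (diagram n (v(i0 := b)))"
proof -
  define J where "J = {i \<in> {1..<i0}. v i0 \<le> v i \<and> v i < b}"
  have inj: "inj_on v J" using placementD(2)[OF v] i0 ab by (auto simp: inj_on_def J_def)
  have "v ` J \<subseteq> {v i0<..<b}"
  proof
    fix x assume "x \<in> v ` J"
    then obtain i where i: "i \<in> {1..<i0}" "x = v i" "v i0 \<le> v i" "v i < b" by (auto simp: J_def)
    have "v i \<noteq> v i0" using placementD(2)[OF v, of i0 i] i i0 ab by auto
    then show "x \<in> {v i0<..<b}" using i by auto
  qed
  then have "card J \<le> card {v i0<..<b}" using card_mono[of "{v i0<..<b}" "v ` J"] card_image[OF inj] by simp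
  then have J: "card J \<le> b - v i0 - 1" by simp
  have "noninv n (v(i0 := b)) \<subseteq> noninv n v \<union> (\<lambda>i. (i, i0)) ` J"
    using later ab by (fastforce simp: noninv_def J_def split: if_splits)
  then have "card (noninv n (v(i0 := b))) \<le> card (noninv n v \<union> (\<lambda>i. (i, i0)) ` J)"
    by (intro card_mono) (auto simp: J_def)
  also have "\<dots> \<le> card (noninv n v) + card ((\<lambda>i. (i, i0)) ` J)" by (rule card_Un_le)
  also have "\<dots> \<le> card (noninv n v) + card J"
    by (intro add_left_mono card_image_le) (simp add: J_def)
  finally have N: "card (noninv n (v(i0 := b))) \<le> card (noninv n v) + (b - v i0 - 1)" using J by linarith
  have "(\<Sum>i\<in>{1..n}. (v(i0 := b)) i - 1) = (b - 1) + (\<Sum>i\<in>{1..n} - {i0}. v i - 1)"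
    using i0 by (subst sum.remove[of _ i0]) (auto intro!: sum.cong)
  moreover have "(\<Sum>i\<in>{1..n}. v i - 1) = (v i0 - 1) + (\<Sum>i\<in>{1..n} - {i0}. v i - 1)"
    using i0 by (intro sum.remove) auto
  moreover have "1 \<le> v i0" using placementD(1)[OF v i0] by simp
  ultimately show ?thesis
    using N ab card_diagram_noninv[OF v] card_diagram_noninv[OF vb] by linarith
qed

section \<open>Comparison of placements by their dot counts\<close>

lemma dots_diff:
  assumes "q \<le> q'"
  shows "dots f p q' = dots f p q + card {i \<in> {1..p}. q < f i \<and> f i \<le> q'}"
proof -
  have "{i \<in> {1..p}. f i \<le> q'} = {i \<in> {1..p}. f i \<le> q} \<union> {i \<in> {1..p}. q < f i \<and> f i \<le> q'}"
    using assms by auto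
  then show ?thesis unfolding dots_def by (simp, subst card_Un_disjoint) auto
qed

text \<open>Monotonicity of the codimension in Bruhat order: \<open>v\<close> is moved towards \<open>f\<close> by elementary
  steps in the first row where they differ, each of which enlarges the diagram.\<close>

lemma card_diagram_strict_mono:
  assumes "placement n v" and f: "placement n f"
    and "\<And>p q. p \<in> {1..n} \<Longrightarrow> q \<in> {1..n} \<Longrightarrow> dots f p q \<le> dots v p q"
    and "\<exists>i\<in>{1..n}. v i \<noteq> f i"
  shows "card (diagram n v) < card (diagram n f)"
  using assms(1,3,4)
proof (induction "n * n - card (diagram n v)" arbitrary: v rule: less_induct)
  case less
  note v = less.prems(1) and le = less.prems(2)
  define i0 where "i0 = (LEAST i. i \<in> {1..n} \<and> v i \<noteq> f i)"
  have i0: "i0 \<in> {1..n}" "v i0 \<noteq> f i0"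
    using LeastI_ex[of "\<lambda>i. i \<in> {1..n} \<and> v i \<noteq> f i"] less.prems(3) unfolding i0_def[symmetric] by blast+
  have before: "v i = f i" if "i \<in> {1..<i0}" for i
    using not_less_Least[of i "\<lambda>i. i \<in> {1..n} \<and> v i \<noteq> f i"] that i0 unfolding i0_def[symmetric] by auto
  \<comment> \<open>Column \<open>n + 1\<close> is included because the target value
    \<open>b\<close> may be \<open>n + 1\<close>; there both counts equal \<open>p\<close>.\<close>
  have le': "dots f p q \<le> dots v p q" if "p \<in> {1..n}" "q \<in> {1..n + 1}" for p q
  proof (cases "q = n + 1")
    case True
    have "{i \<in> {1..p}. h i \<le> n + 1} = {1..p}" if "placement n h" for h
      using placementD(1)[OF that] \<open>p \<in> {1..n}\<close> by auto
    then show ?thesis using True v f by (simp add: dots_def)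
  next
    case False
    then show ?thesis using le that by auto
  qed
  define a b where "a = v i0" and "b = f i0"
  have a: "1 \<le> a" "a \<le> n + 1" and b: "1 \<le> b" "b \<le> n + 1"
    using placementD(1)[OF v i0(1)] placementD(1)[OF f i0(1)] by (auto simp: a_def b_def)
  have "a < b"
  proof (rule ccontr)
    assume "\<not> a < b"
    then have "b < a" using i0(2) by (simp add: a_def b_def)
    have "{i \<in> {1..i0}. v i \<le> b} \<subset> {i \<in> {1..i0}. f i \<le> b}"
    proof
      show "{i \<in> {1..i0}. v i \<le> b} \<subseteq> {i \<in> {1..i0}. f i \<le> b}"
        using before \<open>b < a\<close> by (force simp: a_def le_less)
      have "i0 \<in> {i \<in> {1..i0}. f i \<le> b} - {i \<in> {1..i0}. v i \<le> b}"
        using i0 \<open>b < a\<close> by (auto simp: a_def b_def)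
      then show "{i \<in> {1..i0}. v i \<le> b} \<noteq> {i \<in> {1..i0}. f i \<le> b}" by blast
    qed
    then have "dots v i0 b < dots f i0 b" unfolding dots_def by (intro psubset_card_mono) auto
    then show False using le'[of i0 b] i0(1) b by auto
  qed
  \<comment> \<open>Every dot of \<open>v\<close> in the columns from \<open>q + 1\<close> to
    \<open>b\<close> lies in a row before \<open>i0\<close>, where \<open>v\<close> and
    \<open>f\<close> agree, and \<open>f\<close> has its dot in row \<open>i0\<close> in addition.
    Comparing the counts up to column \<open>b\<close> forces a deficit of \<open>f\<close> up to
    column \<open>q\<close>.\<close>
  have gap: "dots f p q + 1 \<le> dots v p q"
    if p: "i0 \<le> p" "p \<le> n" and q: "a \<le> q" "q < b"
      and none: "\<And>i. i0 < i \<Longrightarrow> i \<le> p \<Longrightarrow> v i \<le> a \<or> b < v i" for p q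
  proof -
    have "insert i0 {i \<in> {1..p}. q < v i \<and> v i \<le> b} \<subseteq> {i \<in> {1..p}. q < f i \<and> f i \<le> b}"
    proof (intro subsetI)
      fix i assume "i \<in> insert i0 {i \<in> {1..p}. q < v i \<and> v i \<le> b}"
      then consider "i = i0" | "i \<in> {1..p}" "q < v i" "v i \<le> b" "i \<noteq> i0" by auto
      then show "i \<in> {i \<in> {1..p}. q < f i \<and> f i \<le> b}"
      proof cases
        case 1
        then show ?thesis using i0 p q by (auto simp: b_def)
      next
        case 2
        then have "\<not> i0 < i" using none[of i] q by auto
        then show ?thesis using 2 before[of i] by auto
      qed
    qed
    then have "card (insert i0 {i \<in> {1..p}. q < v i \<and> v i \<le> b}) \<le> card {i \<in> {1..p}. q < f i \<and> f i \<le> b}"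
      by (intro card_mono) auto
    moreover have "i0 \<notin> {i \<in> {1..p}. q < v i \<and> v i \<le> b}" using q by (auto simp: a_def)
    ultimately have "card {i \<in> {1..p}. q < v i \<and> v i \<le> b} + 1 \<le> card {i \<in> {1..p}. q < f i \<and> f i \<le> b}"
      by simp
    moreover have "dots f p b \<le> dots v p b" using le'[of p b] p i0(1) b by auto
    ultimately show ?thesis using dots_diff[of q b f p] dots_diff[of q b v p] q by linarith
  qed
  have step: ?case
    if w: "placement n w" "card (diagram n v) < card (diagram n w)"
      "\<And>p q. p \<in> {1..n} \<Longrightarrow> q \<in> {1..n} \<Longrightarrow> dots f p q \<le> dots w p q" for w
  proof (cases "\<exists>i\<in>{1..n}. w i \<noteq> f i")
    case True
    have "n * n - card (diagram n w) < n * n - card (diagram n v)"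
      using w(2) card_diagram_le[of n w] by linarith
    then show ?thesis using less.hyps[OF _ w(1,3) True] w(2) by simp
  next
    case False
    then have "diagram n w = diagram n f" by (fastforce simp: diagram_def grid_def)
    then show ?thesis using w(2) by simp
  qed
  \<comment> \<open>Moving the dot of row \<open>i0\<close> from \<open>a\<close> to
    \<open>b'\<close> loses a dot only for \<open>a \<le> q < b'\<close>, exactly where
    \<open>gap\<close> provides one to spare.\<close>
  have drop: "dots f p q \<le> dots w p q"
    if p: "i0 \<le> p" "p \<le> n" and q: "q \<in> {1..n}" and b': "b' \<le> b"
      and none: "\<And>i. i0 < i \<Longrightarrow> i \<le> p \<Longrightarrow> v i \<le> a \<or> b < v i"
      and w: "\<And>i. i \<in> {1..p} \<Longrightarrow> i \<noteq> i0 \<Longrightarrow> w i = v i" "w i0 = b'" for p q w b'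
  proof (cases "a \<le> q \<and> q < b'")
    case True
    have "{i \<in> {1..p}. v i \<le> q} \<subseteq> insert i0 {i \<in> {1..p}. w i \<le> q}" using w by auto
    then have "dots v p q \<le> card (insert i0 {i \<in> {1..p}. w i \<le> q})"
      unfolding dots_def by (intro card_mono) auto
    also have "\<dots> \<le> dots w p q + 1" unfolding dots_def by (simp add: card_insert_if)
    finally show ?thesis using gap[OF p _ _ none, of q] True b' by auto
  next
    case False
    have "{i \<in> {1..p}. v i \<le> q} \<subseteq> {i \<in> {1..p}. w i \<le> q}"
    proof
      fix i assume i: "i \<in> {i \<in> {1..p}. v i \<le> q}"
      show "i \<in> {i \<in> {1..p}. w i \<le> q}"
      proof (cases "i = i0")
        case True
        then show ?thesis using i w(2) False by (auto simp: a_def)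
      next
        case False
        then show ?thesis using i w(1)[of i] by auto
      qed
    qed
    then have "dots v p q \<le> dots w p q" unfolding dots_def by (intro card_mono) auto
    then show ?thesis using le'[of p q] p q i0(1) by auto
  qed
  show ?case
  proof (cases "\<exists>i. i0 < i \<and> i \<le> n \<and> a < v i \<and> v i \<le> b")
    case True
    \<comment> \<open>Taking the first such row leaves no value in \<open>(a, b]\<close> between
      \<open>i0\<close> and \<open>i1\<close>, so the swap adds exactly one box.\<close>
    define i1 where "i1 = (LEAST i. i0 < i \<and> i \<le> n \<and> a < v i \<and> v i \<le> b)"
    have i1: "i0 < i1" "i1 \<le> n" "a < v i1" "v i1 \<le> b"
      using LeastI_ex[OF True] unfolding i1_def[symmetric] by auto
    have mid: "v i \<le> a \<or> b < v i" if "i0 < i" "i < i1" for i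
      using not_less_Least[of i "\<lambda>i. i0 < i \<and> i \<le> n \<and> a < v i \<and> v i \<le> b"] that i1
      unfolding i1_def[symmetric] by auto
    let ?w = "v \<circ> Transposition.transpose i0 i1"
    show ?thesis
    proof (rule step)
      show "placement n ?w" using v i0(1) i1 by (intro placement_swap) auto
      have "v i < v i0 \<or> v i1 < v i" if "i0 < i" "i < i1" for i
      proof -
        have "v i \<noteq> a"
          using placementD(2)[OF v, of i0 i] i0(1) i1 that b by (auto simp: a_def)
        then show ?thesis using mid[OF that] i1(4) by (auto simp: a_def)
      qed
      then have "card (diagram n ?w) = card (diagram n v) + 1"
        using card_diagram_swap[OF v, of i0 i1] i0(1) i1 by (auto simp: a_def)
      then show "card (diagram n v) < card (diagram n ?w)" by simp
      fix p q assume p: "p \<in> {1..n}" and q: "q \<in> {1..n}"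
      consider "p < i0" | "i0 \<le> p" "p < i1" | "i1 \<le> p" by linarith
      then show "dots f p q \<le> dots ?w p q"
      proof cases
        case 1
        then have "{i \<in> {1..p}. ?w i \<le> q} = {i \<in> {1..p}. v i \<le> q}"
          using i1 by (auto simp: transpose_def)
        then show ?thesis using le[OF p q] by (simp add: dots_def)
      next
        case 2
        show ?thesis
          by (rule drop[of p q "v i1"]) (use 2 p q i1 mid in \<open>auto simp: transpose_def\<close>)
      next
        case 3
        have t: "Transposition.transpose i0 i1 permutes {1..p}" using 3 i1 i0(1) by (simp add: permutes_swap_id)
        have "bij_betw (Transposition.transpose i0 i1) {i \<in> {1..p}. ?w i \<le> q} {i \<in> {1..p}. v i \<le> q}"
        proof (rule bij_betwI[where g = "Transposition.transpose i0 i1"])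
          show "Transposition.transpose i0 i1 \<in> {i \<in> {1..p}. ?w i \<le> q} \<rightarrow> {i \<in> {1..p}. v i \<le> q}"
            and "Transposition.transpose i0 i1 \<in> {i \<in> {1..p}. v i \<le> q} \<rightarrow> {i \<in> {1..p}. ?w i \<le> q}"
            using permutes_in_image[OF t] by (simp_all only: Pi_iff mem_Collect_eq o_def transpose_involutory) blast+
        qed simp_all
        then have "dots v p q = dots ?w p q"
          unfolding dots_def by (rule bij_betw_same_card[symmetric])
        then show ?thesis using le[OF p q] by simp
      qed
    qed
  next
    case False
    then have later: "v i \<le> a \<or> b < v i" if "i0 < i" "i \<le> n" for i using that by force
    let ?w = "v(i0 := b)"
    have w: "placement n ?w"
    proof -
      \<comment> \<open>Column \<open>b\<close> is free for the dot of row \<open>i0\<close>: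
        earlier rows agree with the placement \<open>f\<close>, which uses \<open>b\<close> in row
        \<open>i0\<close>, and later rows avoid the interval.\<close>
      have only: "i = i0" if "i \<in> {1..n}" "v i = b" "b \<le> n" for i
      proof (rule ccontr)
        assume "i \<noteq> i0"
        then consider "i < i0" | "i0 < i" by linarith
        then show False
        proof cases
          case 1
          then have "f i = f i0" using before[of i] that by (auto simp: b_def)
          then show False using placementD(2)[OF f, of i i0] i0(1) that \<open>i \<noteq> i0\<close> by (auto simp: b_def)
        next
          case 2
          then show False using later[of i] that \<open>a < b\<close> by auto
        qed
      qed
      show ?thesis
      proof (rule placementI)
        fix i assume i: "i \<in> {1..n}"
        then show "?w i \<in> {1..n + 1}" using placementD(1)[OF v i] b by simp
        fix i' assume i': "i' \<in> {1..n}" "?w i = ?w i'" "?w i \<le> n"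
        show "i = i'"
        proof (cases "i = i0 \<or> i' = i0")
          case True
          then show ?thesis using only[OF i] only[OF i'(1)] i'(2,3) by (auto split: if_splits)
        next
          case False
          then show ?thesis using placementD(2)[OF v i i'(1)] i' by simp
        qed
      qed
    qed
    show ?thesis
    proof (rule step[OF w])
      show "card (diagram n v) < card (diagram n ?w)"
        using card_diagram_raise[OF v i0(1) _ b(2) _ w] \<open>a < b\<close> later by (auto simp: a_def)
      fix p q assume p: "p \<in> {1..n}" and q: "q \<in> {1..n}"
      show "dots f p q \<le> dots ?w p q"
      proof (cases "p < i0")
        case True
        then have "{i \<in> {1..p}. ?w i \<le> q} = {i \<in> {1..p}. v i \<le> q}" by auto
        then show ?thesis using le[OF p q] by (simp add: dots_def)
      next
        case False
        then show ?thesis by (intro drop[of p q b]) (use p q later in auto)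
      qed
    qed
  qed
qed

section \<open>Coxeter length\<close>

lemma permutes_nat_range:
  fixes w :: "nat \<Rightarrow> nat"
  assumes "w permutes {1..n}" "i \<in> {1..n}"
  shows "1 \<le> w i" "w i \<le> n"
  using permutes_in_image[OF assms(1), of i] assms(2) by auto

lemma placement_permutes:
  assumes "w permutes {1..n}"
  shows "placement n w"
proof (rule placementI)
  fix i i' assume "i \<in> {1..n}"
  then show "w i \<in> {1..n + 1}" using permutes_nat_range[OF assms] by fastforce
  assume "w i = w i'"
  then show "i = i'" using injD[OF permutes_inj[OF assms]] by blast
qed

lemma rothe_eq_diagram:
  assumes w: "w permutes {1..n}"
  shows "rothe n w = diagram n w"
proof -
  have "Hilbert_Choice.inv w j > i \<longleftrightarrow> (\<forall>i'\<in>{1..<i}. w i' \<noteq> j)" if "(i, j) \<in> grid n" "j < w i" for i j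
  proof
    assume "Hilbert_Choice.inv w j > i"
    then show "\<forall>i'\<in>{1..<i}. w i' \<noteq> j" using permutes_inverses(2)[OF w] by fastforce
  next
    assume none: "\<forall>i'\<in>{1..<i}. w i' \<noteq> j"
    have wj: "w (Hilbert_Choice.inv w j) = j" using permutes_inverses(1)[OF w] .
    have "Hilbert_Choice.inv w j \<in> {1..n}"
      using permutes_in_image[OF permutes_inv[OF w], of j] that by (auto simp: grid_def)
    then have "\<not> Hilbert_Choice.inv w j < i" using none wj by force
    moreover have "Hilbert_Choice.inv w j \<noteq> i" using wj that by auto
    ultimately show "Hilbert_Choice.inv w j > i" by simp
  qed
  then show ?thesis unfolding rothe_def diagram_def by blast
qed

lemma nw_rank_eq_dots:
  assumes w: "w permutes {1..n}" and "p \<le> n"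
  shows "nw_rank w p q = dots w p q"
proof -
  have "bij_betw fst {(i, j). i \<in> {1..p} \<and> j \<in> {1..q} \<and> w i = j} {i \<in> {1..p}. w i \<le> q}"
    using permutes_nat_range[OF w] assms(2)
    by (intro bij_betw_byWitness[where f' = "\<lambda>i. (i, w i)"]) auto
  then show ?thesis unfolding nw_rank_def dots_def by (rule bij_betw_same_card)
qed

lemma card_diagram_adjacent_swap:
  assumes "w permutes {1..n}" "i \<in> {1..<n}" "w i < w (i + 1)"
  shows "card (diagram n (w \<circ> Transposition.transpose i (i + 1))) = card (diagram n w) + 1"
  using assms by (intro card_diagram_swap placement_permutes) auto

lemma permutes_adjacent_swap:
  fixes w :: "nat \<Rightarrow> nat"
  assumes "w permutes {1..n}" "i \<in> {1..<n}"
  shows "w \<circ> Transposition.transpose i (i + 1) permutes {1..n}"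
  using assms by (intro permutes_compose permutes_swap_id) auto

lemma no_descent_imp_id:
  fixes w :: "nat \<Rightarrow> nat"
  assumes w: "w permutes {1..n}" and mono: "\<And>i. i \<in> {1..<n} \<Longrightarrow> w i < w (i + 1)"
  shows "w = id"
proof
  fix i
  show "w i = id i"
  proof (cases "i \<in> {1..n}")
    case True
    have lower: "k \<in> {1..n} \<Longrightarrow> k \<le> w k" for k
    proof (induction k)
      case (Suc k)
      then show ?case using mono[of k] permutes_nat_range[OF w, of "Suc k"] by (cases "k = 0") force+
    qed simp
    have "k \<in> {1..n} \<Longrightarrow> w k + (n - k) \<le> n" for k
    proof (induction "n - k" arbitrary: k)
      case 0
      then show ?case using permutes_nat_range[OF w, of k] by auto
    next
      case (Suc d)
      then have "w (k + 1) + (n - (k + 1)) \<le> n" by (intro Suc.hyps(1)) auto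
      moreover have "w k < w (k + 1)" using mono[of k] Suc by auto
      ultimately show ?case using Suc.hyps(2) by linarith
    qed
    from this[OF True] lower[OF True] True show ?thesis by auto
  next
    case False
    then show ?thesis using permutes_not_in[OF w] by simp
  qed
qed

lemma card_diagram_id: "card (diagram n id) = 0"
proof -
  have "diagram n id = {}" by (force simp: diagram_def grid_def)
  then show ?thesis by simp
qed

text \<open>Undoing a descent removes one box, and a permutation without descents is the
  identity.\<close>

lemma reduced_word_exists:
  assumes "w permutes {1..n}"
  shows "\<exists>is. length is = card (diagram n w) \<and> set is \<subseteq> {1..<n} \<and>
     w = foldr (\<circ>) (map (\<lambda>i. Transposition.transpose i (i + 1)) is) id"
  using assms
proof (induction "card (diagram n w)" arbitrary: w rule: less_induct)
  case less
  show ?case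
  proof (cases "\<forall>i\<in>{1..<n}. w i < w (i + 1)")
    case True
    then have "w = id" using no_descent_imp_id[OF less.prems] by blast
    then show ?thesis by (intro exI[of _ "[]"]) (simp add: card_diagram_id)
  next
    case False
    then obtain i where i: "i \<in> {1..<n}" "\<not> w i < w (i + 1)" by auto
    let ?s = "Transposition.transpose i (i + 1)"
    let ?u = "w \<circ> ?s"
    have uu: "?u \<circ> ?s = w" by (simp add: fun_eq_iff)
    have u: "?u permutes {1..n}" using permutes_adjacent_swap[OF less.prems i(1)] .
    have "w i \<noteq> w (i + 1)" by (simp add: inj_eq[OF permutes_inj[OF less.prems]])
    then have "?u i < ?u (i + 1)" using i(2) by simp
    from card_diagram_adjacent_swap[OF u i(1) this]
    have L: "card (diagram n w) = card (diagram n ?u) + 1" by (simp only: uu)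
    then obtain l where l: "length l = card (diagram n ?u)" "set l \<subseteq> {1..<n}"
      "?u = foldr (\<circ>) (map (\<lambda>i. Transposition.transpose i (i + 1)) l) id"
      using less.hyps[OF _ u] by auto
    have foldr_comp: "foldr (\<circ>) fs h = foldr (\<circ>) fs id \<circ> h" for fs and h :: "nat \<Rightarrow> nat"
      by (induction fs) (auto simp: o_assoc)
    have "w = ?u \<circ> ?s" by (simp only: uu)
    also have "\<dots> = foldr (\<circ>) (map (\<lambda>i. Transposition.transpose i (i + 1)) (l @ [i])) id"
      using foldr_comp[of "map (\<lambda>i. Transposition.transpose i (i + 1)) l" ?s] l(3) by simp
    finally show ?thesis using l L i(1) by (intro exI[of _ "l @ [i]"]) auto
  qed
qed

text \<open>Letters act on positions from the right, hence induction from the end of the word; each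
  letter changes the number of boxes by one, up or down.\<close>

lemma word_length_ge:
  assumes "set is \<subseteq> {1..<n}"
  defines "w \<equiv> foldr (\<circ>) (map (\<lambda>i. Transposition.transpose i (i + 1)) is) id"
  shows "w permutes {1..n} \<and> card (diagram n w) \<le> length is"
  using assms(1) unfolding w_def
proof (induction "is" rule: rev_induct)
  case Nil
  show ?case by (simp add: permutes_id[unfolded id_def] card_diagram_id[unfolded id_def])
next
  case (snoc i l)
  let ?s = "Transposition.transpose i (i + 1)"
  let ?u = "foldr (\<circ>) (map (\<lambda>i. Transposition.transpose i (i + 1)) l) id"
  have i: "i \<in> {1..<n}" and l: "set l \<subseteq> {1..<n}" using snoc.prems by auto
  have u: "?u permutes {1..n}" "card (diagram n ?u) \<le> length l"
    by (rule conjunct1[OF snoc.IH[OF l]], rule conjunct2[OF snoc.IH[OF l]])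
  have foldr_comp: "foldr (\<circ>) fs h = foldr (\<circ>) fs id \<circ> h" for fs and h :: "nat \<Rightarrow> nat"
    by (induction fs) (auto simp: o_assoc)
  have eq: "foldr (\<circ>) (map (\<lambda>i. Transposition.transpose i (i + 1)) (l @ [i])) id = ?u \<circ> ?s"
    using foldr_comp[of "map (\<lambda>i. Transposition.transpose i (i + 1)) l" ?s] by simp
  have us: "?u \<circ> ?s permutes {1..n}" using permutes_adjacent_swap[OF u(1) i] .
  have "card (diagram n (?u \<circ> ?s)) \<le> card (diagram n ?u) + 1"
  proof (cases "?u i < ?u (i + 1)")
    case True
    then show ?thesis using card_diagram_adjacent_swap[OF u(1) i] by simp
  next
    case False
    have "?u i \<noteq> ?u (i + 1)" by (subst inj_eq[OF permutes_inj[OF u(1)]]) simp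
    then have "(?u \<circ> ?s) i < (?u \<circ> ?s) (i + 1)" using False by simp
    from card_diagram_adjacent_swap[OF us i this]
    have "card (diagram n (?u \<circ> ?s \<circ> ?s)) = card (diagram n (?u \<circ> ?s)) + 1" .
    moreover have "?u \<circ> ?s \<circ> ?s = ?u" by (simp add: fun_eq_iff)
    ultimately show ?thesis by (simp only:)
  qed
  then have "card (diagram n (?u \<circ> ?s)) \<le> length (l @ [i])" using u(2) by (simp only: length_append) simp
  then show ?case using us unfolding eq by blast
qed

lemma coxeter_length_eq_card_diagram:
  assumes "w permutes {1..n}"
  shows "coxeter_length n w = card (diagram n w)"
  unfolding coxeter_length_def
proof (rule Least_equality)
  show "\<exists>is. length is = card (diagram n w) \<and> set is \<subseteq> {1..<n} \<and>
     w = foldr (\<circ>) (map (\<lambda>i. Transposition.transpose i (i + 1)) is) id"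
    using reduced_word_exists[OF assms] .
next
  fix k assume "\<exists>is. length is = k \<and> set is \<subseteq> {1..<n} \<and>
     w = foldr (\<circ>) (map (\<lambda>i. Transposition.transpose i (i + 1)) is) id"
  then show "card (diagram n w) \<le> k" using word_length_ge by blast
qed

section \<open>Strata with given pivots\<close>

text \<open>Rows are reduced only by rows above them and are not permuted, so pivots need not
  increase with \<open>i\<close>. In return, their dot counts recover the rank of every northwest
  submatrix.\<close>

definition pivot :: "nat \<Rightarrow> point \<Rightarrow> nat \<Rightarrow> nat" where
  "pivot n a i = (if row_dep a i n then n + 1 else (LEAST q. \<not> row_dep a i q))"

lemma row_dep_0 [simp]: "row_dep a i 0"
  by (simp add: row_dep_def)

lemma pivot_le_iff:
  assumes "q \<le> n"
  shows "pivot n a i \<le> q \<longleftrightarrow> \<not> row_dep a i q"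
proof (cases "row_dep a i n")
  case True
  then show ?thesis using assms row_dep_mono[OF True assms] by (simp add: pivot_def)
next
  case False
  then show ?thesis
    using LeastI[of "\<lambda>q. \<not> row_dep a i q" n] Least_le[of "\<lambda>q. \<not> row_dep a i q" q]
      row_dep_mono[of a i q "LEAST q. \<not> row_dep a i q"]
    by (auto simp: pivot_def)
qed

lemma pivot_range: "pivot n a i \<in> {1..n + 1}"
proof -
  have "\<not> pivot n a i \<le> 0" by (simp only: pivot_le_iff row_dep_0) simp
  moreover have "pivot n a i \<le> n + 1"
    using pivot_le_iff[of n n a i] by (cases "row_dep a i n") (auto simp: pivot_def)
  ultimately show ?thesis by simp
qed

lemma dots_pivot: "q \<le> n \<Longrightarrow> dots (pivot n a) p q = rk a p q"
  by (simp add: dots_def rk_eq_card_rows pivot_le_iff)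

lemma rk_Suc_col_le: "rk a p (Suc q) \<le> rk a p q + 1"
  by (simp add: rk_Suc_col)

text \<open>Two rows with the same pivot column would raise the rank by 2 when this one column is
  added.\<close>

lemma placement_pivot: "placement n (pivot n a)"
proof (rule placementI)
  fix i show "pivot n a i \<in> {1..n + 1}" by (rule pivot_range)
next
  fix i i' assume i: "i \<in> {1..n}" "i' \<in> {1..n}" "pivot n a i = pivot n a i'" "pivot n a i \<le> n"
  define q where "q = pivot n a i - 1"
  have q: "pivot n a i = Suc q" using pivot_range[of n a i] by (simp add: q_def)
  have "{i, i'} \<subseteq> {l \<in> {1..n}. q < pivot n a l \<and> pivot n a l \<le> Suc q}" using i q by auto
  then have "card {i, i'} \<le> card {l \<in> {1..n}. q < pivot n a l \<and> pivot n a l \<le> Suc q}"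
    by (intro card_mono) auto
  then have "dots (pivot n a) n q + card {i, i'} \<le> dots (pivot n a) n (Suc q)"
    using dots_diff[of q "Suc q" "pivot n a" n] by simp
  then have "card {i, i'} \<le> 1" using rk_Suc_col_le[of a n q] i(4) q by (simp add: dots_pivot)
  then show "i = i'" by (cases "i = i'") auto
qed

text \<open>The last row is kept if it is independent of the earlier ones in the first
  \<open>q\<close> columns; otherwise its relation is absorbed into their coefficients.\<close>

lemma combination_of_pivot_rows:
  "\<exists>y. \<forall>j\<in>{1..q}. (\<Sum>i\<in>{1..<p}. c i * a (i, j)) = (\<Sum>i\<in>{i \<in> {1..<p}. \<not> row_dep a i q}. y i * a (i, j))"
proof (induction p arbitrary: c)
  case 0
  show ?case by simp
next
  case (Suc p)
  show ?case
  proof (cases "p = 0")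
    case True
    then show ?thesis by simp
  next
    case False
    then have ins: "{1..<Suc p} = insert p {1..<p}" by auto
    show ?thesis
    proof (cases "row_dep a p q")
      case True
      then obtain z where z: "\<forall>j\<in>{1..q}. a (p, j) = (\<Sum>i\<in>{1..<p}. z i * a (i, j))"
        unfolding row_dep_def by auto
      have "{i \<in> {1..<Suc p}. \<not> row_dep a i q} = {i \<in> {1..<p}. \<not> row_dep a i q}"
        using True unfolding ins by auto
      moreover have "(\<Sum>i\<in>{1..<Suc p}. c i * a (i, j)) = (\<Sum>i\<in>{1..<p}. (c i + c p * z i) * a (i, j))"
        if "j \<in> {1..q}" for j
        using z that unfolding ins by (simp add: distrib_right sum.distrib sum_distrib_left mult.assoc)
      ultimately show ?thesis using Suc.IH[of "\<lambda>i. c i + c p * z i"] by simp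
    next
      case False
      obtain y where y: "\<forall>j\<in>{1..q}. (\<Sum>i\<in>{1..<p}. c i * a (i, j))
          = (\<Sum>i\<in>{i \<in> {1..<p}. \<not> row_dep a i q}. y i * a (i, j))"
        using Suc.IH by blast
      have eq: "{i \<in> {1..<Suc p}. \<not> row_dep a i q} = insert p {i \<in> {1..<p}. \<not> row_dep a i q}"
        using False unfolding ins by auto
      let ?J = "{i \<in> {1..<p}. \<not> row_dep a i q}"
      show ?thesis unfolding eq
      proof (intro exI ballI)
        fix j assume j: "j \<in> {1..q}"
        have "(\<Sum>i\<in>?J. (y(p := c p)) i * a (i, j)) = (\<Sum>i\<in>?J. y i * a (i, j))"
          by (intro sum.cong) auto
        then have "(\<Sum>i\<in>insert p ?J. (y(p := c p)) i * a (i, j)) = c p * a (p, j) + (\<Sum>i\<in>?J. y i * a (i, j))"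
          by (subst sum.insert) auto
        moreover have "(\<Sum>i\<in>{1..<Suc p}. c i * a (i, j)) = c p * a (p, j) + (\<Sum>i\<in>{1..<p}. c i * a (i, j))"
          unfolding ins by simp
        ultimately show "(\<Sum>i\<in>{1..<Suc p}. c i * a (i, j)) = (\<Sum>i\<in>insert p ?J. (y(p := c p)) i * a (i, j))"
          using y j by simp
      qed
    qed
  qed
qed

text \<open>All matrices with pivots \<open>f\<close>, row by row: the entries from the pivot on are free, and those
  before it combine the earlier pivot rows; the coefficient of row \<open>i'\<close> is stored at \<open>(i, f i')\<close>,
  so that the parameters are indexed by the complement of the diagram.\<close>

function stratum :: "(nat \<Rightarrow> nat) \<Rightarrow> point \<Rightarrow> nat \<Rightarrow> nat \<Rightarrow> complex" where
  "stratum f x i j = (if f i \<le> j then x (i, j)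
     else (\<Sum>i'\<in>{i' \<in> {1..<i}. f i' < f i}. x (i, f i') * stratum f x i' j))"
  by pat_completeness auto
termination by (relation "measure (\<lambda>(f, x, i, j). i)") auto

declare stratum.simps [simp del]

lemma polyfun_stratum:
  assumes f: "placement n f" and "i \<in> {1..n}" and j: "j \<in> {1..n}"
  shows "(\<lambda>x. stratum f x i j) \<in> polyfun (grid n - diagram n f)"
  using assms(2)
proof (induction i rule: less_induct)
  case (less i)
  have var: "(\<lambda>x. x v) \<in> polyfun (grid n - diagram n f)" if "v \<in> grid n - diagram n f" for v
    using polyfun_le_var[of "grid n - diagram n f" v] that unfolding polyfun_def by auto
  show ?case
  proof (cases "f i \<le> j")
    case True
    then have "(i, j) \<in> grid n - diagram n f" using less.prems j by (auto simp: grid_def diagram_def)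
    from var[OF this] True show ?thesis by (simp add: stratum.simps)
  next
    case False
    have "(\<lambda>x. \<Sum>i'\<in>{i' \<in> {1..<i}. f i' < f i}. x (i, f i') * stratum f x i' j) \<in> polyfun (grid n - diagram n f)"
    proof (intro polyfun_sum polyfun_mult var)
      fix i' assume i': "i' \<in> {i' \<in> {1..<i}. f i' < f i}"
      then show "(i, f i') \<in> grid n - diagram n f"
        using less.prems placementD(1)[OF f, of i'] placementD(1)[OF f, of i]
        by (auto simp: grid_def diagram_def)
      show "(\<lambda>x. stratum f x i' j) \<in> polyfun (grid n - diagram n f)"
        using i' less by auto
    qed
    then show ?thesis using False by (simp add: stratum.simps[abs_def])
  qed
qed

lemma stratum_surj:
  fixes a :: point
  assumes f: "\<And>i. i \<in> {1..n} \<Longrightarrow> f i = pivot n a i"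
  shows "\<exists>x. \<forall>i\<in>{1..n}. \<forall>j\<in>{1..n}. a (i, j) = stratum f x i j"
proof -
  have "\<exists>y. \<forall>j\<in>{1..<f i}. a (i, j) = (\<Sum>i'\<in>{i' \<in> {1..<i}. f i' < f i}. y i' * a (i', j))"
    if i: "i \<in> {1..n}" for i
  proof -
    define q where "q = f i - 1"
    have q: "f i = Suc q" "q \<le> n" using pivot_range[of n a i] f[OF i] by (auto simp: q_def)
    then have "row_dep a i q" using pivot_le_iff[OF q(2), of a i] f[OF i] by auto
    then obtain z where z: "\<forall>j\<in>{1..q}. a (i, j) = (\<Sum>i'\<in>{1..<i}. z i' * a (i', j))"
      unfolding row_dep_def by auto
    obtain y where y: "\<forall>j\<in>{1..q}. (\<Sum>i'\<in>{1..<i}. z i' * a (i', j))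
        = (\<Sum>i'\<in>{i' \<in> {1..<i}. \<not> row_dep a i' q}. y i' * a (i', j))"
      using combination_of_pivot_rows[where q = q and p = i and c = z and a = a] by auto
    \<comment> \<open>As \<open>q = f i - 1\<close>, the rows independent within the first
      \<open>q\<close> columns are those whose pivot precedes that of row \<open>i\<close>.\<close>
    have "{i' \<in> {1..<i}. \<not> row_dep a i' q} = {i' \<in> {1..<i}. f i' < f i}"
      using f i q pivot_le_iff[OF q(2), of a] by (auto simp: less_Suc_eq_le)
    then show ?thesis using y z q by (intro exI[of _ y]) (auto simp: less_Suc_eq_le)
  qed
  then have "\<forall>i\<in>{1..n}. \<exists>y. \<forall>j\<in>{1..<f i}.
      a (i, j) = (\<Sum>i'\<in>{i' \<in> {1..<i}. f i' < f i}. y i' * a (i', j))"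
    by (rule ballI)
  from bchoice[OF this] obtain y where "\<forall>i\<in>{1..n}. \<forall>j\<in>{1..<f i}.
      a (i, j) = (\<Sum>i'\<in>{i' \<in> {1..<i}. f i' < f i}. y i i' * a (i', j))"
    by (rule exE)
  then have y: "a (i, j) = (\<Sum>i'\<in>{i' \<in> {1..<i}. f i' < f i}. y i i' * a (i', j))"
    if "i \<in> {1..n}" "j \<in> {1..<f i}" for i j
    using that by blast
  \<comment> \<open>Inverts the storage convention: left of the pivot, the column \<open>j\<close>
    identifies the row \<open>i'\<close> with \<open>f i' = j\<close>. Cells of the diagram get
    arbitrary values, which \<open>stratum\<close> never reads.\<close>
  define x where "x = (\<lambda>(i, j). if f i \<le> j then a (i, j) else y i (THE i'. i' \<in> {1..<i} \<and> f i' = j))"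
  have "a (i, j) = stratum f x i j" if "i \<in> {1..n}" "j \<in> {1..n}" for i j
    using that(1)
  proof (induction i rule: less_induct)
    case (less i)
    show ?case
    proof (cases "f i \<le> j")
      case True
      then show ?thesis by (simp add: stratum.simps x_def)
    next
      case False
      have "a (i, j) = (\<Sum>i'\<in>{i' \<in> {1..<i}. f i' < f i}. y i i' * a (i', j))"
        using False that(2) by (intro y less.prems) auto
      also have "\<dots> = (\<Sum>i'\<in>{i' \<in> {1..<i}. f i' < f i}. x (i, f i') * stratum f x i' j)"
      proof (intro sum.cong refl arg_cong2[of _ _ _ _ "(*)"])
        fix i' assume i': "i' \<in> {i' \<in> {1..<i}. f i' < f i}"
        then show "a (i', j) = stratum f x i' j" using less by auto
        have "(THE l. l \<in> {1..<i} \<and> f l = f i') = i'"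
        proof (rule the_equality)
          fix l assume l: "l \<in> {1..<i} \<and> f l = f i'"
          then show "l = i'"
            using placementD(2)[OF placement_pivot, of l n i' a] i' f less.prems pivot_range[of n a i]
            by auto
        qed (use i' in auto)
        then show "y i i' = x (i, f i')" using i' by (simp add: x_def)
      qed
      finally show ?thesis using False by (subst stratum.simps) simp
    qed
  qed
  then show ?thesis by blast
qed

section \<open>Matrices of deficient rank in a matrix Schubert variety\<close>

lemma matrix_schubert_iff:
  assumes "v permutes {1..n}"
  shows "a \<in> matrix_schubert n v \<longleftrightarrow>
    a \<in> aff (grid n) \<and> (\<forall>p\<in>{1..n}. \<forall>q\<in>{1..n}. rk a p q \<le> dots v p q)"
  using nw_rank_eq_dots[OF assms] by (auto simp: matrix_schubert_def rk_def)

text \<open>By its size, \<open>T\<close> has as many coordinates as the stratum of \<open>v\<close>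
  has parameters. A rank drop at a single corner excludes this stratum, and each of the finitely
  many others has too few parameters to be dense.\<close>

lemma nondense_low_rank:
  assumes v: "v permutes {1..n}" and T: "T \<subseteq> grid n" "card T + card (diagram n v) = n * n"
    and "p0 \<le> n" "q0 \<le> n"
  shows "nondense T ((\<lambda>a. restrict a T) ` {a \<in> matrix_schubert n v. rk a p0 q0 < dots v p0 q0})"
proof -
  define F where "F = {f \<in> {1..n} \<rightarrow>\<^sub>E {1..n + 1}. placement n f \<and> card (diagram n v) < card (diagram n f)}"
  have "finite F" unfolding F_def by (intro finite_subset[OF _ finite_PiE[of "{1..n}" "\<lambda>_. {1..n + 1}"]]) auto
  have finT: "finite T" using T(1) finite_grid by (rule finite_subset)
  have "nondense T (range (\<lambda>x. restrict (\<lambda>(i, j). stratum f x i j) T))" if f: "f \<in> F" for f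
  proof (rule nondense_image)
    show "finite (grid n - diagram n f)" by simp
    have "card (grid n - diagram n f) = n * n - card (diagram n f)"
      by (simp add: card_Diff_subset diagram_subset)
    moreover have "card (diagram n v) < card (diagram n f)" using f by (simp add: F_def)
    ultimately show "card (grid n - diagram n f) < card T"
      using T(2) card_diagram_le[of n f] by linarith
    fix u assume "u \<in> T"
    then show "(\<lambda>x. (case u of (i, j) \<Rightarrow> stratum f x i j)) \<in> polyfun (grid n - diagram n f)"
      using polyfun_stratum[of n f] T(1) f by (cases u) (auto simp: F_def grid_def)
  qed (rule finT)
  then have "nondense T (\<Union>f\<in>F. range (\<lambda>x. restrict (\<lambda>(i, j). stratum f x i j) T))"
    using \<open>finite F\<close> by (intro nondense_UN)
  then show ?thesis
  proof (rule nondense_subset, intro subsetI)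
    fix b assume "b \<in> (\<lambda>a. restrict a T) ` {a \<in> matrix_schubert n v. rk a p0 q0 < dots v p0 q0}"
    then obtain a where a: "a \<in> matrix_schubert n v" "rk a p0 q0 < dots v p0 q0" "b = restrict a T" by auto
    define f where "f = restrict (pivot n a) {1..n}"
    have f: "f i = pivot n a i" if "i \<in> {1..n}" for i using that by (simp add: f_def)
    have dots_f: "dots f p q = rk a p q" if "p \<le> n" "q \<le> n" for p q
    proof -
      have "{i \<in> {1..p}. f i \<le> q} = {i \<in> {1..p}. pivot n a i \<le> q}" using f that(1) by auto
      then show ?thesis using dots_pivot[OF that(2), of a p] by (simp add: dots_def)
    qed
    have pf: "placement n f"
    proof (rule placementI)
      fix i assume i: "i \<in> {1..n}"
      then show "f i \<in> {1..n + 1}" using f pivot_range by metis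
      fix i' assume "i' \<in> {1..n}" "f i = f i'" "f i \<le> n"
      then show "i = i'" using placementD(2)[OF placement_pivot i, of i' a] f i by simp
    qed
    \<comment> \<open>Pivots equal to \<open>v\<close> would give the corner the full rank
      \<open>dots v p0 q0\<close>.\<close>
    have "\<exists>i\<in>{1..n}. v i \<noteq> f i"
    proof (rule ccontr)
      assume "\<not> (\<exists>i\<in>{1..n}. v i \<noteq> f i)"
      then have "{i \<in> {1..p0}. f i \<le> q0} = {i \<in> {1..p0}. v i \<le> q0}" using assms(4) by auto
      then show False using dots_f[OF assms(4,5)] a(2) by (simp add: dots_def)
    qed
    then have "card (diagram n v) < card (diagram n f)"
      using a(1) matrix_schubert_iff[OF v] dots_f
      by (intro card_diagram_strict_mono placement_permutes v pf) auto
    then have "f \<in> F" using pf pivot_range[of n a] unfolding F_def f_def by simp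
    moreover obtain x where "\<forall>i\<in>{1..n}. \<forall>j\<in>{1..n}. a (i, j) = stratum f x i j"
      using stratum_surj[of n f a] f by blast
    then have "b = restrict (\<lambda>(i, j). stratum f x i j) T"
      using a(3) T(1) by (auto simp: grid_def restrict_def fun_eq_iff)
    ultimately show "b \<in> (\<Union>f\<in>F. range (\<lambda>x. restrict (\<lambda>(i, j). stratum f x i j) T))" by blast
  qed
qed

section \<open>Projections of the two varieties\<close>

lemma rk_mono_col: "rk a p q \<le> rk a p (Suc q)"
  by (simp add: rk_Suc_col)

text \<open>The hypotheses force the \<open>r\<close> by \<open>c\<close> block to have rank exactly
  \<open>k\<close>, unchanged by adding its next row or its next column. Rank \<open>k\<close> for
  the enlarged block then prescribes the corner entry, since the relation among the columns must
  extend to the new row.\<close>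

lemma rk_completion:
  assumes low: "k \<le> rk a r c" and col: "rk a r (Suc c) \<le> k" and row: "rk a (Suc r) c \<le> k"
  shows "\<exists>t. \<forall>s. rk (a((Suc r, Suc c) := s)) (Suc r) (Suc c) \<le> k \<longleftrightarrow> s = t"
proof -
  let ?b = "\<lambda>s. a((Suc r, Suc c) := s)"
  have "col_dep a r (Suc c)"
    using low col rk_Suc_col[of a r c] by (auto split: if_splits)
  then obtain x where x: "\<forall>i\<in>{1..r}. a (i, Suc c) = (\<Sum>j\<in>{1..<Suc c}. x j * a (i, j))"
    unfolding col_dep_def by blast
  define t where "t = (\<Sum>j\<in>{1..<Suc c}. x j * a (Suc r, j))"
  have "rk (?b s) (Suc r) (Suc c) \<le> k \<longleftrightarrow> s = t" for s
  proof
    assume le: "rk (?b s) (Suc r) (Suc c) \<le> k"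
    have "rk (?b s) r (Suc c) = rk a r (Suc c)" by (rule rk_cong) auto
    then have "k \<le> rk (?b s) r (Suc c)" using low rk_mono_col[of a r c] by simp
    then have "row_dep (?b s) (Suc r) (Suc c)"
      using le rk_Suc_row[of "?b s" r "Suc c"] by (auto split: if_splits)
    then obtain y where y: "\<And>j. j \<in> {1..Suc c} \<Longrightarrow>
        ?b s (Suc r, j) = (\<Sum>i\<in>{1..<Suc r}. y i * ?b s (i, j))"
      unfolding row_dep_def by blast
    have y': "?b s (Suc r, j) = (\<Sum>i\<in>{1..<Suc r}. y i * a (i, j))" if "j \<in> {1..Suc c}" for j
      unfolding y[OF that] by (intro sum.cong) auto
    have "s = (\<Sum>i\<in>{1..<Suc r}. y i * a (i, Suc c))" using y'[of "Suc c"] by simp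
    \<comment> \<open>The row relation \<open>y\<close> and the column relation \<open>x\<close>
      both evaluate the same double sum: one gives the corner \<open>s\<close>, the other
      \<open>t\<close>.\<close>
    also have "\<dots> = (\<Sum>i\<in>{1..<Suc r}. \<Sum>j\<in>{1..<Suc c}. x j * (y i * a (i, j)))"
      using x by (intro sum.cong refl) (simp add: sum_distrib_left mult_ac del: sum.op_ivl_Suc)
    also have "\<dots> = (\<Sum>j\<in>{1..<Suc c}. x j * (\<Sum>i\<in>{1..<Suc r}. y i * a (i, j)))"
      by (subst sum.swap) (simp add: sum_distrib_left del: sum.op_ivl_Suc)
    also have "\<dots> = t" unfolding t_def
    proof (intro sum.cong refl arg_cong2[of _ _ _ _ "(*)"])
      fix j assume "j \<in> {1..<Suc c}"
      then show "(\<Sum>i\<in>{1..<Suc r}. y i * a (i, j)) = a (Suc r, j)" using y'[of j] by auto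
    qed
    finally show "s = t" .
  next
    assume "s = t"
    have "?b s (i, Suc c) = (\<Sum>j\<in>{1..<Suc c}. x j * ?b s (i, j))" if "i \<in> {1..Suc r}" for i
    proof -
      have "(\<Sum>j\<in>{1..<Suc c}. x j * ?b s (i, j)) = (\<Sum>j\<in>{1..<Suc c}. x j * a (i, j))"
        by (intro sum.cong) auto
      then show ?thesis using x that \<open>s = t\<close> by (cases "i = Suc r") (auto simp: t_def)
    qed
    then have "col_dep (?b s) (Suc r) (Suc c)" unfolding col_dep_def by blast
    then have "rk (?b s) (Suc r) (Suc c) = rk (?b s) (Suc r) c" by (simp add: rk_Suc_col)
    also have "\<dots> = rk a (Suc r) c" by (rule rk_cong) auto
    finally show "rk (?b s) (Suc r) (Suc c) \<le> k" using row by simp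
  qed
  then show ?thesis by blast
qed

lemma dots_Suc_row: "dots v (Suc p) q = dots v p q + (if v (Suc p) \<le> q then 1 else 0)"
  unfolding dots_def by (rule card_filter_Suc)

lemma dots_Suc_col:
  assumes v: "v permutes {1..n}" and "p \<le> n"
  shows "dots v p (Suc q) = dots v p q + (if \<exists>i\<in>{1..p}. v i = Suc q then 1 else 0)"
proof -
  have "card {i \<in> {1..p}. q < v i \<and> v i \<le> Suc q} = (if \<exists>i\<in>{1..p}. v i = Suc q then 1 else 0)"
  proof (cases "\<exists>i\<in>{1..p}. v i = Suc q")
    case True
    then obtain i where i: "i \<in> {1..p}" "v i = Suc q" by blast
    have "{i \<in> {1..p}. q < v i \<and> v i \<le> Suc q} = {i}"
    proof (intro equalityI subsetI)
      fix l assume "l \<in> {i \<in> {1..p}. q < v i \<and> v i \<le> Suc q}"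
      then have "v l = v i" using i(2) by auto
      then show "l \<in> {i}" using injD[OF permutes_inj[OF v]] by blast
    qed (use i in auto)
    then show ?thesis using True by simp
  next
    case False
    then have "{i \<in> {1..p}. q < v i \<and> v i \<le> Suc q} = {}" by (auto simp: le_Suc_eq)
    then show ?thesis using False by simp
  qed
  then show ?thesis using dots_diff[of q "Suc q" v p] by simp
qed

text \<open>Rank conditions off the diagram follow from those one step further up or to the left.\<close>

lemma rank_conditions_region:
  assumes v: "v permutes {1..n}"
    and outer: "\<And>p q. p \<in> {1..n} \<Longrightarrow> q \<in> {1..n} \<Longrightarrow> p < r \<or> q < c \<Longrightarrow> rk a p q \<le> dots v p q"
    and diag: "\<And>p q. (p, q) \<in> diagram n v \<Longrightarrow> r \<le> p \<Longrightarrow> c \<le> q \<Longrightarrow> rk a p q \<le> dots v p q"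
    and "p \<in> {1..n}" "q \<in> {1..n}"
  shows "rk a p q \<le> dots v p q"
  using assms(4,5)
proof (induction "p + q" arbitrary: p q rule: less_induct)
  case less
  obtain p' q' where pq: "p = Suc p'" "q = Suc q'" using less.prems by (cases p; cases q) auto
  have up: "rk a p' q \<le> dots v p' q"
    using less.hyps[of p' q] less.prems pq by (cases "p' = 0") auto
  have left: "rk a p q' \<le> dots v p q'"
    using less.hyps[of p q'] less.prems pq by (cases "q' = 0") auto
  show ?case
  proof (cases "p < r \<or> q < c")
    case True
    then show ?thesis using outer less.prems by blast
  next
    case False
    show ?thesis
    proof (cases "(p, q) \<in> diagram n v")
      case True
      then show ?thesis using diag False by auto
    next
      case notin: False
      \<comment> \<open>A dot in row \<open>p\<close> weakly left of the cell, or in column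
        \<open>q\<close> weakly above it, pays for the rank increase of at most one.\<close>
      then have "v p \<le> q \<or> (\<exists>i\<in>{1..p}. v i = q)"
        using less.prems by (force simp: diagram_def grid_def)
      then show ?thesis
      proof
        assume "v p \<le> q"
        then have "dots v p q = dots v p' q + 1" using pq by (simp add: dots_Suc_row)
        moreover have "rk a p q \<le> rk a p' q + 1" using pq by (simp add: rk_Suc_row)
        ultimately show ?thesis using up by simp
      next
        assume "\<exists>i\<in>{1..p}. v i = q"
        then have "dots v p q = dots v p q' + 1" using pq less.prems dots_Suc_col[OF v, of p q'] by simp
        moreover have "rk a p q \<le> rk a p q' + 1" using pq by (simp add: rk_Suc_col)
        ultimately show ?thesis using left by simp
      qed
    qed
  qed
qed

lemma restrict_upd_in: "restrict (a(e := t)) (insert e T) = (restrict a T)(e := t)"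
  by (auto simp: fun_eq_iff restrict_def)

lemma restrict_upd_notin: "e \<notin> T \<Longrightarrow> restrict (a(e := t)) T = restrict a T"
  by (auto simp: fun_eq_iff restrict_def)

text \<open>Away from \<open>Z\<close>, the set \<open>X\<close> is the graph of a function expressing the coordinate \<open>e\<close> in terms
  of the others on the base of the cylinder \<open>X'\<close>.\<close>

lemma proj_degree_graph:
  assumes fin: "finite T" and e: "e \<notin> T"
    and sub: "X \<subseteq> X'" and cyl: "\<And>a t. a \<in> X' \<Longrightarrow> a(e := t) \<in> X'"
    and cylZ: "\<And>a t. a \<in> Z \<Longrightarrow> a(e := t) \<in> Z"
    and graph: "\<And>a. a \<in> X' - Z \<Longrightarrow> \<exists>t. \<forall>s. a(e := s) \<in> X \<longleftrightarrow> s = t"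
    and Z: "nondense (insert e T) ((\<lambda>a. restrict a (insert e T)) ` Z)"
  shows "proj_degree X T = proj_degree X' (insert e T)"
proof (rule proj_degree_eqI)
  let ?T' = "insert e T"
  define B where "B = (\<lambda>a. restrict a T) ` Z"
  \<comment> \<open>\<open>Z\<close> is a cylinder in direction \<open>e\<close>, so every slice of
    its projection contains \<open>B\<close>; one non-dense slice is enough.\<close>
  obtain t0 where "nondense T {b \<in> aff T. b(e := t0) \<in> (\<lambda>a. restrict a ?T') ` Z}"
    using nondense_slice[OF fin e Z] by blast
  then have B: "nondense T B"
  proof (rule nondense_subset)
    show "B \<subseteq> {b \<in> aff T. b(e := t0) \<in> (\<lambda>a. restrict a ?T') ` Z}"
    proof
      fix b assume "b \<in> B"
      then obtain a where a: "a \<in> Z" "b = restrict a T" by (auto simp: B_def)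
      have "b(e := t0) = restrict (a(e := t0)) ?T'" using a(2) by (simp add: restrict_upd_in)
      then show "b \<in> {b \<in> aff T. b(e := t0) \<in> (\<lambda>a. restrict a ?T') ` Z}"
        using cylZ[OF a(1)] a(2) restrict_in_aff by blast
    qed
  qed
  have Baff: "B \<subseteq> aff T" by (auto simp: B_def restrict_in_aff)
  show "finite T" "finite ?T'" using fin by auto
  \<comment> \<open>Outside \<open>B\<close> the entry at \<open>e\<close> is determined for points
    of \<open>X\<close> and arbitrary for points of \<open>X'\<close>, so overwriting it by
    \<open>t\<close> loses nothing and reaches the whole fibre over
    \<open>b(e := t)\<close>.\<close>
  have bij: "bij_betw (\<lambda>a. a(e := t)) {a \<in> X. restrict a T = b} {a \<in> X'. restrict a ?T' = b(e := t)}"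
    if b: "b \<in> aff T - B" for b t
    unfolding bij_betw_def
  proof
    show "inj_on (\<lambda>a. a(e := t)) {a \<in> X. restrict a T = b}"
    proof (rule inj_onI)
      fix a a' assume a: "a \<in> {a \<in> X. restrict a T = b}" "a' \<in> {a \<in> X. restrict a T = b}"
        and eq: "a(e := t) = a'(e := t)"
      have "a \<in> X' - Z" using a(1) sub b by (auto simp: B_def)
      then obtain s where s: "\<And>s'. a(e := s') \<in> X \<longleftrightarrow> s' = s" using graph by blast
      have a': "a' = a(e := a' e)"
      proof -
        have "a' = (a'(e := t))(e := a' e)" by simp
        also have "\<dots> = (a(e := t))(e := a' e)" using eq by simp
        finally show ?thesis by simp
      qed
      have "a(e := a e) \<in> X" using a(1) by simp
      moreover have "a(e := a' e) \<in> X" using a(2) a' by simp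
      ultimately have "a e = a' e" using s by metis
      then show "a = a'" using a' by (metis fun_upd_triv)
    qed
    show "(\<lambda>a. a(e := t)) ` {a \<in> X. restrict a T = b} = {a \<in> X'. restrict a ?T' = b(e := t)}"
    proof (intro equalityI subsetI)
      fix a' assume "a' \<in> (\<lambda>a. a(e := t)) ` {a \<in> X. restrict a T = b}"
      then obtain a where a: "a' = a(e := t)" "a \<in> X" "restrict a T = b" by blast
      have "a' \<in> X'" unfolding a(1) using a(2) sub by (intro cyl) blast
      moreover have "restrict a' ?T' = b(e := t)" unfolding a(1) a(3)[symmetric] by (rule restrict_upd_in)
      ultimately show "a' \<in> {a \<in> X'. restrict a ?T' = b(e := t)}" by simp
    next
      fix a' assume "a' \<in> {a \<in> X'. restrict a ?T' = b(e := t)}"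
      then have a': "a' \<in> X'" "restrict a' ?T' = b(e := t)" by auto
      have "restrict a' T = restrict (restrict a' ?T') T" by (auto simp: fun_eq_iff restrict_def)
      also have "\<dots> = restrict b T" unfolding a'(2) using e by (rule restrict_upd_notin)
      also have "\<dots> = b" using b by (auto simp: aff_def PiE_restrict)
      finally have rb: "restrict a' T = b" .
      then have "a' \<in> X' - Z" using a'(1) b by (auto simp: B_def)
      then obtain s where "a'(e := s) \<in> X" using graph by blast
      moreover have "restrict (a'(e := s)) T = b" using rb restrict_upd_notin[OF e] by metis
      moreover have "a' e = t" using fun_cong[OF a'(2), of e] by simp
      then have "a' = (a'(e := s))(e := t)" by auto
      ultimately show "a' \<in> (\<lambda>a. a(e := t)) ` {a \<in> X. restrict a T = b}" by blast
    qed
  qed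
  have upd_aff: "b(e := t) \<in> aff ?T'" if "b \<in> aff T" for b t
    using that by (simp add: aff_def PiE_def extensional_def)
  show "nondense T ((\<lambda>a. restrict a T) ` X) \<longleftrightarrow> nondense ?T' ((\<lambda>a. restrict a ?T') ` X')"
  proof
    assume "nondense T ((\<lambda>a. restrict a T) ` X)"
    then have "nondense T ((\<lambda>a. restrict a T) ` X \<union> B)" using B by (rule nondense_Un)
    then have "nondense ?T' {b \<in> aff ?T'. restrict b T \<in> (\<lambda>a. restrict a T) ` X \<union> B}"
      using fin by (intro nondense_cylinder) auto
    then show "nondense ?T' ((\<lambda>a. restrict a ?T') ` X')"
    proof (rule nondense_subset, intro subsetI)
      fix b assume "b \<in> (\<lambda>a. restrict a ?T') ` X'"
      then obtain a where a: "a \<in> X'" "b = restrict a ?T'" by blast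
      have rb: "restrict b T = restrict a T" using a(2) by (auto simp: fun_eq_iff restrict_def)
      have "restrict a T \<in> (\<lambda>a. restrict a T) ` X \<union> B"
      proof (cases "a \<in> Z")
        case True
        then show ?thesis by (simp add: B_def)
      next
        case False
        then obtain s where "a(e := s) \<in> X" using graph a(1) by blast
        then have "restrict (a(e := s)) T \<in> (\<lambda>a. restrict a T) ` X" by (rule imageI)
        then show ?thesis unfolding restrict_upd_notin[OF e] by (rule UnI1)
      qed
      then show "b \<in> {b \<in> aff ?T'. restrict b T \<in> (\<lambda>a. restrict a T) ` X \<union> B}"
        using rb a(2) restrict_in_aff by simp
    qed
  next
    assume "nondense ?T' ((\<lambda>a. restrict a ?T') ` X')"
    then obtain t where "nondense T {b \<in> aff T. b(e := t) \<in> (\<lambda>a. restrict a ?T') ` X'}"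
      using nondense_slice[OF fin e] by blast
    then show "nondense T ((\<lambda>a. restrict a T) ` X)"
    proof (rule nondense_subset, intro subsetI)
      fix b assume "b \<in> (\<lambda>a. restrict a T) ` X"
      then obtain a where a: "a \<in> X" "b = restrict a T" by blast
      then have "b(e := t) = restrict (a(e := t)) ?T'" by (simp add: restrict_upd_in)
      moreover have "a(e := t) \<in> X'" using a(1) sub cyl by blast
      ultimately show "b \<in> {b \<in> aff T. b(e := t) \<in> (\<lambda>a. restrict a ?T') ` X'}"
        using a(2) restrict_in_aff by blast
    qed
  qed
  fix d
  let ?P = "\<lambda>b. finite {a \<in> X. restrict a T = b} \<and> card {a \<in> X. restrict a T = b} = d"
  let ?P' = "\<lambda>b. finite {a \<in> X'. restrict a ?T' = b} \<and> card {a \<in> X'. restrict a ?T' = b} = d"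
  have P: "?P b \<longleftrightarrow> ?P' (b(e := t))" if "b \<in> aff T - B" for b t
    using bij_betw_finite[OF bij[OF that]] bij_betw_same_card[OF bij[OF that]] by simp
  show "(\<exists>A\<subseteq>aff T. nondense T A \<and> (\<forall>b \<in> aff T - A. ?P b))
    \<longleftrightarrow> (\<exists>A\<subseteq>aff ?T'. nondense ?T' A \<and> (\<forall>b \<in> aff ?T' - A. ?P' b))"
  proof
    assume "\<exists>A\<subseteq>aff T. nondense T A \<and> (\<forall>b \<in> aff T - A. ?P b)"
    then obtain A where A: "A \<subseteq> aff T" "nondense T A" "\<And>b. b \<in> aff T - A \<Longrightarrow> ?P b" by blast
    \<comment> \<open>Exceptional sets travel upwards as cylinders and downwards as slices, each
      time enlarged by \<open>B\<close>.\<close>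
    let ?A' = "{b \<in> aff ?T'. restrict b T \<in> A \<union> B}"
    have "nondense ?T' ?A'" using nondense_Un[OF A(2) B] fin by (intro nondense_cylinder) auto
    moreover have "?P' b" if b: "b \<in> aff ?T' - ?A'" for b
    proof -
      have rb: "restrict b T \<in> aff T - A" "restrict b T \<in> aff T - B" using b restrict_in_aff by auto
      have "(restrict b T)(e := b e) = restrict (b(e := b e)) ?T'" by (rule restrict_upd_in[symmetric])
      also have "\<dots> = b" using b by (auto simp: aff_def PiE_restrict)
      finally have eq: "(restrict b T)(e := b e) = b" .
      have "?P' ((restrict b T)(e := b e))"
        using P[OF rb(2), of "b e"] A(3)[OF rb(1)] by (rule iffD1)
      then show ?thesis unfolding eq .
    qed
    ultimately show "\<exists>A\<subseteq>aff ?T'. nondense ?T' A \<and> (\<forall>b \<in> aff ?T' - A. ?P' b)"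
      by (intro exI[of _ ?A']) blast
  next
    assume "\<exists>A\<subseteq>aff ?T'. nondense ?T' A \<and> (\<forall>b \<in> aff ?T' - A. ?P' b)"
    then obtain A where A: "A \<subseteq> aff ?T'" "nondense ?T' A" "\<And>b. b \<in> aff ?T' - A \<Longrightarrow> ?P' b" by blast
    obtain t where t: "nondense T {b \<in> aff T. b(e := t) \<in> A}" using nondense_slice[OF fin e A(2)] by blast
    let ?A = "{b \<in> aff T. b(e := t) \<in> A} \<union> B"
    have "nondense T ?A" using t B by (rule nondense_Un)
    moreover have "?P b" if b: "b \<in> aff T - ?A" for b
    proof -
      have "b \<in> aff T - B" "b(e := t) \<in> aff ?T' - A" using b upd_aff by auto
      from P[OF this(1), of t] A(3)[OF this(2)] show ?thesis by (rule iffD2)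
    qed
    ultimately show "\<exists>A\<subseteq>aff T. nondense T A \<and> (\<forall>b \<in> aff T - A. ?P b)"
      using Baff by (intro exI[of _ ?A]) blast
  qed
qed

section \<open>Coefficients of squarefree monomials\<close>

lemma lookup_zmon:
  assumes "finite S"
  shows "Poly_Mapping.lookup (zmon S) v = (if v \<in> S then 1 else 0)"
  unfolding zmon_def using assms
  by (induction S) (auto simp: lookup_add lookup_single when_def)

lemma zmon_inject:
  assumes fin: "finite S" "finite S'"
  shows "zmon S = zmon S' \<longleftrightarrow> S = S'"
proof
  assume eq: "zmon S = zmon S'"
  show "S = S'"
  proof (rule Set.set_eqI)
    fix v
    have "Poly_Mapping.lookup (zmon S) v = Poly_Mapping.lookup (zmon S') v" by (simp only: eq)
    then show "v \<in> S \<longleftrightarrow> v \<in> S'"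
      unfolding lookup_zmon[OF fin(1)] lookup_zmon[OF fin(2)] by (simp split: if_splits)
  qed
qed simp

lemma lookup_fine_schubert:
  assumes "S \<subseteq> grid n"
  shows "Poly_Mapping.lookup (fine_schubert n w) (zmon S) =
    (if card S = coxeter_length n w then int (proj_degree (matrix_schubert n w) (grid n - S)) else 0)"
proof -
  define \<S> where "\<S> = {S. S \<subseteq> grid n \<and> card S = coxeter_length n w}"
  define d where "d U = int (proj_degree (matrix_schubert n w) (grid n - U))" for U
  have fin: "finite \<S>" by (rule finite_subset[of _ "Pow (grid n)"]) (auto simp: \<S>_def)
  have lookup_sum: "Poly_Mapping.lookup (\<Sum>U\<in>\<A>. f U) m = (\<Sum>U\<in>\<A>. Poly_Mapping.lookup (f U) m)"
    for \<A> :: "(nat \<times> nat) set set" and f :: "(nat \<times> nat) set \<Rightarrow> int mpol" and m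
    by (induction \<A> rule: infinite_finite_induct) (auto simp: lookup_add)
  have "Poly_Mapping.lookup (fine_schubert n w) (zmon S) = (\<Sum>U\<in>\<S>. d U when zmon U = zmon S)"
    unfolding fine_schubert_def \<S>_def[symmetric] d_def by (simp add: lookup_sum lookup_single)
  also have "\<dots> = (\<Sum>U\<in>\<S>. if U = S then d S else 0)"
  proof (intro sum.cong refl)
    fix U assume "U \<in> \<S>"
    then have "finite U" "finite S" using assms by (auto simp: \<S>_def intro: finite_subset)
    then show "(d U when zmon U = zmon S) = (if U = S then d S else 0)"
      by (simp add: zmon_inject when_def)
  qed
  also have "\<dots> = (if S \<in> \<S> then d S else 0)" by (rule sum.delta[OF fin])
  finally show ?thesis using assms by (simp add: \<S>_def d_def)
qed

theorem proposition3p16: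
  fixes n :: nat and w w' :: "nat \<Rightarrow> nat" and r c :: nat and S :: "(nat \<times> nat) set"
  assumes "w permutes {1..n}"
    and "(r, c) \<in> ess n w"
    and "\<forall>(r', c') \<in> rothe n w. (r', c') \<noteq> (r, c) \<longrightarrow> r' < r \<or> c' < c"
    and "w' = w \<circ> Transposition.transpose r (Hilbert_Choice.inv w c)"
    and "S \<subseteq> grid n"
    and "(r, c) \<in> S"
  shows "Poly_Mapping.lookup (fine_schubert n w) (zmon S)
       = Poly_Mapping.lookup (fine_schubert n w') (zmon (S - {(r, c)}))"
proof -
  note w = assms(1)
  \<comment> \<open>The dots \<open>(r, C)\<close> and \<open>(R, c)\<close> of \<open>w\<close> are
    replaced by \<open>(r, c)\<close> and \<open>(R, C)\<close> in \<open>w'\<close>.\<close>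
  define R C where "R = Hilbert_Choice.inv w c" and "C = w r"
  have rc: "1 \<le> r" "r \<le> n" "1 \<le> c" "c \<le> n" "c < C" "r < R"
    using assms(2) by (auto simp: ess_def grid_def R_def C_def)
  have wR: "w R = c" unfolding R_def using permutes_inverses(1)[OF w] .
  have "R \<in> {1..n}"
    unfolding R_def using permutes_in_image[OF permutes_inv[OF w], of c] rc by auto
  then have R: "R \<le> n" by simp
  have w'_def: "w' = w \<circ> Transposition.transpose r R" using assms(4) by (simp add: R_def)
  have w'r: "w' r = c" and w'R: "w' R = C" and w'o: "\<And>i. i \<noteq> r \<Longrightarrow> i \<noteq> R \<Longrightarrow> w' i = w i"
    using wR by (simp_all add: w'_def C_def transpose_def)
  have w': "w' permutes {1..n}"
    unfolding w'_def using w rc R by (intro permutes_compose permutes_swap_id) auto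
  have inj: "w i = w i' \<Longrightarrow> i = i'" for i i' using injD[OF permutes_inj[OF w]] by blast
  have rc_diag: "(p, q) = (r, c)" if "(p, q) \<in> diagram n w" "r \<le> p" "c \<le> q" for p q
    using assms(3) that unfolding rothe_eq_diagram[OF w] by fastforce
  have diagramI: "(p, q) \<in> diagram n w"
    if "1 \<le> p" "p \<le> n" "1 \<le> q" "q < w p" "\<And>i. 1 \<le> i \<Longrightarrow> i < p \<Longrightarrow> w i \<noteq> q" for p q
    using that permutes_nat_range[OF w, of p] by (auto simp: diagram_def grid_def)
  \<comment> \<open>A dot inside the rectangle would produce a second box \<open>(r, w i)\<close> of
    \<open>w\<close> in row \<open>r\<close>, to the right of \<open>(r, c)\<close>.\<close>
  have mid: "w i < c \<or> C < w i" if i: "r < i" "i < R" for i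
  proof (rule ccontr)
    assume "\<not> (w i < c \<or> C < w i)"
    moreover have "w i \<noteq> c" "w i \<noteq> C" using inj[of i R] inj[of i r] wR i by (auto simp: C_def)
    ultimately have wi: "c < w i" "w i < C" by auto
    have "w l \<noteq> w i" if "l < r" for l using inj[of l i] that i by auto
    then have "(r, w i) \<in> diagram n w" using rc wi by (intro diagramI) (auto simp: C_def)
    then show False using rc_diag[of r "w i"] wi by auto
  qed
  have len: "coxeter_length n w = coxeter_length n w' + 1"
  proof -
    have w_eq: "w' \<circ> Transposition.transpose r R = w" by (simp add: w'_def fun_eq_iff)
    have "card (diagram n (w' \<circ> Transposition.transpose r R)) = card (diagram n w') + 1"
    proof (rule card_diagram_swap[OF placement_permutes[OF w']])
      fix i assume "r < i" "i < R"
      then show "w' i < w' r \<or> w' R < w' i" using mid[of i] w'o[of i] w'r w'R by auto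
    qed (use rc R w'r w'R in auto)
    then show ?thesis
      unfolding w_eq coxeter_length_eq_card_diagram[OF w] coxeter_length_eq_card_diagram[OF w'] .
  qed
  \<comment> \<open>Such a box of \<open>w'\<close> yields a box of \<open>w\<close> weakly
    southeast of and different from \<open>(r, c)\<close>: \<open>(r, q)\<close> if
    \<open>p = R\<close>, \<open>(p, c)\<close> if \<open>q = C\<close>, and \<open>(p, q)\<close>
    itself otherwise.\<close>
  have diag': False if d: "(p, q) \<in> diagram n w'" and p: "r \<le> p" and q: "c \<le> q" for p q
  proof -
    have pq: "p \<le> n" "1 \<le> q" "q < w' p" "\<And>i. 1 \<le> i \<Longrightarrow> i < p \<Longrightarrow> w' i \<noteq> q"
      using d by (auto simp: diagram_def grid_def)
    have pr: "p \<noteq> r" using pq(3) w'r q by auto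
    then have "r < p" using p by simp
    then have qc: "q \<noteq> c" using pq(4)[of r] w'r rc by auto
    show False
    proof (cases "p = R")
      case True
      have "w l \<noteq> q" if "1 \<le> l" "l < r" for l using pq(4)[of l] w'o[of l] that True rc by auto
      then have "(r, q) \<in> diagram n w" using rc pq True w'R by (intro diagramI) (auto simp: C_def)
      then show False using rc_diag[of r q] q qc by auto
    next
      case False
      then have wp: "w' p = w p" using w'o pr by simp
      have "q \<noteq> C"
      proof
        assume "q = C"
        have "\<not> R < p" using pq(4)[of R] w'R \<open>q = C\<close> rc by auto
        then have "p < R" using False by simp
        have "w l \<noteq> c" if "l < p" for l using inj[of l R] wR that \<open>p < R\<close> by auto
        then have "(p, c) \<in> diagram n w"
          using rc pq wp \<open>q = C\<close> p by (intro diagramI) auto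
        then show False using rc_diag[of p c] p pr by auto
      qed
      then have "w i \<noteq> q" if "1 \<le> i" "i < p" for i
        using pq(4)[of i] w'o[of i] wR qc that by (cases "i = r"; cases "i = R") (auto simp: C_def)
      then have "(p, q) \<in> diagram n w" using pq p rc wp by (intro diagramI) auto
      then show False using rc_diag[of p q] p q pr by auto
    qed
  qed
  have dots_outer: "dots w p q = dots w' p q" if "p < r \<or> q < c" for p q
  proof -
    have "w i \<le> q \<longleftrightarrow> w' i \<le> q" if "i \<le> p" for i
      using that \<open>p < r \<or> q < c\<close> w'o[of i] w'r w'R wR rc
      by (cases "i = r"; cases "i = R") (auto simp: C_def)
    then have "{i \<in> {1..p}. w i \<le> q} = {i \<in> {1..p}. w' i \<le> q}" by auto
    then show ?thesis by (simp add: dots_def)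
  qed
  obtain r' c' where r': "r = Suc r'" and c': "c = Suc c'" using rc by (cases r; cases c) auto
  define k where "k = dots w r c"
  have no_c: "\<not> (\<exists>i\<in>{1..p}. w i = Suc c')" if "p \<le> r" for p
  proof
    assume "\<exists>i\<in>{1..p}. w i = Suc c'"
    then obtain i where "i \<le> p" "w i = w R" using wR c' by auto
    then show False using inj[of i R] rc(6) that by simp
  qed
  have k_row: "dots w r' q = dots w r q" if "q \<le> c" for q
    using dots_Suc_row[of w r' q] rc(5) that r' by (simp add: C_def)
  have k_col: "dots w p c' = dots w p c" if "p \<le> r" for p
    using dots_Suc_col[OF w, of p c'] no_c[OF that] that rc c' by simp
  \<comment> \<open>The dot of \<open>w\<close> in row \<open>r\<close> is right of column
    \<open>c\<close>, and the one in column \<open>c\<close> is below row \<open>r\<close>; deleting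
    this row or column from the corner keeps the count \<open>k\<close>.\<close>
  have k: "dots w' r' c = k" "dots w' r c' = k" "dots w' r' c' = k"
    using dots_outer[of r' c] dots_outer[of r c'] dots_outer[of r' c'] k_row[of c] k_row[of c']
      k_col[of r] k_col[of r'] r' c' by (auto simp: k_def)
  define X X' where "X = matrix_schubert n w" and "X' = matrix_schubert n w'"
  \<comment> \<open>None of the remaining conditions involves the entry at \<open>(r, c)\<close>, so
    \<open>X'\<close> is a cylinder in this direction.\<close>
  have X'_iff: "a \<in> X' \<longleftrightarrow> a \<in> aff (grid n) \<and>
      (\<forall>p\<in>{1..n}. \<forall>q\<in>{1..n}. p < r \<or> q < c \<longrightarrow> rk a p q \<le> dots w' p q)" for a
    using rank_conditions_region[OF w', of r c a] diag'
    unfolding X'_def matrix_schubert_iff[OF w'] by blast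
  have X_iff: "a \<in> X \<longleftrightarrow> a \<in> X' \<and> rk a r c \<le> k" for a
  proof
    assume "a \<in> X"
    then have aff: "a \<in> aff (grid n)"
      and le: "\<And>p q. p \<in> {1..n} \<Longrightarrow> q \<in> {1..n} \<Longrightarrow> rk a p q \<le> dots w p q"
      unfolding X_def matrix_schubert_iff[OF w] by blast+
    have "rk a p q \<le> dots w' p q" if "p \<in> {1..n}" "q \<in> {1..n}" "p < r \<or> q < c" for p q
      using le[OF that(1,2)] dots_outer[OF that(3)] by simp
    moreover have "rk a r c \<le> k" unfolding k_def using rc by (intro le) auto
    ultimately show "a \<in> X' \<and> rk a r c \<le> k" using aff unfolding X'_iff by blast
  next
    assume a: "a \<in> X' \<and> rk a r c \<le> k"
    have "rk a p q \<le> dots w p q" if "p \<in> {1..n}" "q \<in> {1..n}" for p q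
    proof (rule rank_conditions_region[OF w _ _ that, of r c a])
      fix p q assume "p \<in> {1..n}" "q \<in> {1..n}" "p < r \<or> q < c"
      then have "rk a p q \<le> dots w' p q" using a unfolding X'_iff by blast
      then show "rk a p q \<le> dots w p q" using dots_outer[OF \<open>p < r \<or> q < c\<close>] by simp
    next
      fix p q assume "(p, q) \<in> diagram n w" "r \<le> p" "c \<le> q"
      then have "p = r" "q = c" using rc_diag by blast+
      then show "rk a p q \<le> dots w p q" using a by (simp add: k_def)
    qed
    then show "a \<in> X" using a unfolding X_def matrix_schubert_iff[OF w] X'_iff by blast
  qed
  have rk_upd: "rk (a((r, c) := t)) p q = rk a p q" if "p < r \<or> q < c" for a t p q
    using that by (intro rk_cong) auto
  have cyl: "a((r, c) := t) \<in> X'" if "a \<in> X'" for a t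
  proof -
    have "a((r, c) := t) \<in> aff (grid n)"
      using that rc unfolding X'_iff by (auto simp: aff_def grid_def PiE_def extensional_def)
    then show ?thesis using that rk_upd unfolding X'_iff by simp
  qed
  define Z where "Z = {a \<in> X'. rk a r' c' < k}"
  \<comment> \<open>For \<open>r' = 0\<close> or \<open>c' = 0\<close> the border submatrix is empty
    and has rank 0, a case that the conditions defining \<open>X'\<close> do not list.\<close>
  have graph: "\<exists>t. \<forall>s. a((r, c) := s) \<in> X \<longleftrightarrow> s = t" if a: "a \<in> X' - Z" for a
  proof -
    have "k \<le> rk a r' c'" using a by (auto simp: Z_def)
    moreover have "rk a r' c \<le> k"
      using a rc r' k(1) by (cases "r' = 0") (auto simp: X'_iff)
    moreover have "rk a r c' \<le> k"
      using a rc c' k(2) by (cases "c' = 0") (auto simp: X'_iff)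
    ultimately have "\<exists>t. \<forall>s. rk (a((r, c) := s)) r c \<le> k \<longleftrightarrow> s = t"
      using rk_completion[of k a r' c'] r' c' by simp
    then show ?thesis using cyl a by (simp add: X_iff)
  qed
  show ?thesis
  proof (cases "card S = coxeter_length n w")
    case False
    have finS: "finite S" using assms(5) finite_grid by (rule finite_subset)
    have "card S = card (S - {(r, c)}) + 1"
      using card_Suc_Diff1[OF finS assms(6)] by simp
    then have "card (S - {(r, c)}) \<noteq> coxeter_length n w'" using False len by simp
    moreover have "S - {(r, c)} \<subseteq> grid n" using assms(5) by auto
    ultimately show ?thesis using False assms(5) by (simp add: lookup_fine_schubert)
  next
    case True
    have finS: "finite S" using assms(5) finite_grid by (rule finite_subset)
    have "card S = card (S - {(r, c)}) + 1"
      using card_Suc_Diff1[OF finS assms(6)] by simp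
    then have cS: "card (S - {(r, c)}) = coxeter_length n w'" using True len by simp
    define T where "T = grid n - S"
    have T': "grid n - (S - {(r, c)}) = insert (r, c) T" using assms(5,6) by (auto simp: T_def)
    have sub': "S - {(r, c)} \<subseteq> grid n" using assms(5) by auto
    \<comment> \<open>The coordinates kept for \<open>w'\<close> are those kept for \<open>w\<close>
      together with \<open>(r, c)\<close>; their number is the one required by
      \<open>nondense_low_rank\<close>.\<close>
    have "card (insert (r, c) T) + card (S - {(r, c)}) = n * n"
      unfolding T'[symmetric] using card_Diff_subset[OF finite_subset[OF sub'] sub'] card_mono[OF _ sub'] by simp
    then have "card (insert (r, c) T) + card (diagram n w') = n * n"
      using cS coxeter_length_eq_card_diagram[OF w'] by simp
    moreover have "insert (r, c) T \<subseteq> grid n" unfolding T'[symmetric] by auto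
    ultimately have "nondense (insert (r, c) T) ((\<lambda>a. restrict a (insert (r, c) T)) ` Z)"
      using nondense_low_rank[OF w', of "insert (r, c) T" r' c'] rc r' c' k(3) by (simp add: Z_def X'_def)
    then have "proj_degree X T = proj_degree X' (insert (r, c) T)"
    proof (rule proj_degree_graph[rotated 6])
      show "finite T" by (simp add: T_def)
      show "(r, c) \<notin> T" using assms(6) by (simp add: T_def)
      show "X \<subseteq> X'" using X_iff by blast
      show "a((r, c) := t) \<in> X'" if "a \<in> X'" for a t using cyl[OF that] .
      show "a((r, c) := t) \<in> Z" if "a \<in> Z" for a t
        using that cyl rk_upd[of r' c'] r' unfolding Z_def by simp
      show "\<exists>t. \<forall>s. a((r, c) := s) \<in> X \<longleftrightarrow> s = t" if "a \<in> X' - Z" for a using graph[OF that] .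
    qed
    then show ?thesis
      using True cS lookup_fine_schubert[OF assms(5)] lookup_fine_schubert[OF sub']
      by (simp add: T' T_def X_def X'_def)
  qed
qed

end
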